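(* Let $G$ be a topological group, put $G^2=G\times G$, let $p\colon E\to B$ be a $G$-fibration, and let $i\colon E\times_{E/G}E\hookrightarrow E\times_{B/G}E$ be the inclusion map. Suppose there exist cohomology classes $u_1,\dots,u_k\in\widetilde{H}^{*}_{G^2}(E\times_{B/G}E;R)$ (for any commutative ring $R$) such that $$(i^h_{G^2})^*(u_1)=\cdots=(i^h_{G^2})^*(u_k)=0\quad\text{and}\quad u_1\smile\cdots\smile u_k\ne 0.$$ Then $\mathrm{TC}^G[p\colon E\to B]>k$.
   Context: All spaces are Hausdorff, $I=[0,1]$, path spaces carry the compact-open topology. A $G$-map is a continuous equivariant map; a $G$-homotopy is an equivariant homotopy ($G$ acting trivially on $I$). A $G$-fibration is a $G$-map with the $G$-homotopy lifting property with respect to every $G$-space. Borel cohomology: for a topological group $\Gamma$ with universal principal $\Gamma$-bundle $E\Gamma\to B\Gamma$ and a $\Gamma$-space $X$, $X^h_\Gamma=E\Gamma\times_\Gamma X$ is the homotopy orbit space, the quotient of $E\Gamma\times X$ by $(eg,x)\sim(e,gx)$; $H^*_\Gamma(X;R)=H^*(X^h_\Gamma;R)$, and $\widetilde{H}^*_\Gamma(X;R)=\widetilde{H}^*(X^h_\Gamma;R)$ is its reduced version. A $\Gamma$-map $f\colon X\to Y$ induces $f^h_\Gamma\colon X^h_\Gamma\to Y^h_\Gamma$. Equivariant sectional category: for a $G$-map $q\colon X\to Y$, $\mathrm{secat}_G(q)$ is the least positive integer $k$ such that $Y$ has a cover by $G$-invariant open sets $U_1,\dots,U_k$ with $G$-maps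 $s_i\colon U_i\to X$ such that $q\circ s_i$ is $G$-homotopic to the inclusion $U_i\hookrightarrow Y$ ($\infty$ if there is no such $k$). Invariant parametrized topological complexity: for a $G$-fibration $p\colon E\to B$, let $E^I_B$ be the space of paths $\gamma\colon I\to E$ whose image lies in a single fibre of $p$, with $(g\cdot\gamma)(t)=g\cdot\gamma(t)$. Put $E^I_B\times_{E/G}E^I_B=\{(\gamma,\delta)\in E^I_B\times E^I_B : G\cdot\gamma(1)=G\cdot\delta(0)\}$, $E\times_{B/G}E=\{(e_1,e_2)\in E\times E : G\cdot p(e_1)=G\cdot p(e_2)\}$ and $E\times_{E/G}E=\{(e_1,e_2)\in E\times E: G\cdot e_1=G\cdot e_2\}$, with the componentwise $(G\times G)$-actions, and let $\Psi(\gamma,\delta)=(\gamma(0),\delta(1))$, a $(G\times G)$-fibration $E^I_B\times_{E/G}E^I_B\to E\times_{B/G}E$. Then $\mathrm{TC}^G[p\colon E\to B]:=\mathrm{secat}_{G\times G}(\Psi)$. *)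

theory Defs
  imports
    "HOL-Analysis.Analysis"
    "HOL-Homology.Homology"
    "HOL-Algebra.Group_Action"
    "HOL-Algebra.QuotRing"
    "HOL-Library.Extended_Nat"
begin

section \<open>Function spaces and quotient spaces\<close>

abbreviation unit_interval :: "real topology" where
  "unit_interval \<equiv> top_of_set {0..1}"

text \<open>The case where \<open>K\<close> and \<open>U\<close> are both empty makes the whole function space open.\<close>

definition compact_open :: "'a topology \<Rightarrow> 'b topology \<Rightarrow> ('a \<Rightarrow> 'b) topology" where
  "compact_open X Y = topology_generated_by
     {{f \<in> extensional (topspace X). continuous_map X Y f \<and> f ` K \<subseteq> U} | K U.
        compactin X K \<and> openin Y U}"

definition quotient_topology :: "'a topology \<Rightarrow> ('a \<Rightarrow> 'b) \<Rightarrow> 'b topology" where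
  "quotient_topology X q =
     topology (\<lambda>V. V \<subseteq> q ` topspace X \<and> openin X {x \<in> topspace X. q x \<in> V})"

lemma openin_quotient_topology:
  "openin (quotient_topology X q) V \<longleftrightarrow>
     V \<subseteq> q ` topspace X \<and> openin X {x \<in> topspace X. q x \<in> V}"
proof -
  have eq1: "{x \<in> topspace X. q x \<in> S \<inter> T} =
      {x \<in> topspace X. q x \<in> S} \<inter> {x \<in> topspace X. q x \<in> T}" for S T
    by auto
  have eq2: "{x \<in> topspace X. q x \<in> \<Union>\<K>} = (\<Union>K\<in>\<K>. {x \<in> topspace X. q x \<in> K})" for \<K>
    by auto
  have "istopology (\<lambda>V. V \<subseteq> q ` topspace X \<and> openin X {x \<in> topspace X. q x \<in> V})"
    unfolding istopology_def eq1 eq2 by (auto intro: openin_Union)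
  then show ?thesis
    by (simp add: quotient_topology_def topology_inverse')
qed

lemma topspace_quotient_topology: "topspace (quotient_topology X q) = q ` topspace X"
proof -
  have "openin (quotient_topology X q) (q ` topspace X)"
    by (simp add: openin_quotient_topology) (metis (mono_tags, lifting) imageI openin_subopen mem_Collect_eq openin_topspace subsetI)
  moreover have "topspace (quotient_topology X q) \<subseteq> q ` topspace X"
    using openin_topspace[of "quotient_topology X q"] unfolding openin_quotient_topology by (rule conjunct1)
  ultimately show ?thesis
    by (intro subset_antisym) (auto dest: openin_subset)
qed

lemma quotient_map_quotient_topology: "quotient_map X (quotient_topology X q) q"
  by (auto simp: quotient_map_def topspace_quotient_topology openin_quotient_topology)


section \<open>Topological groups and equivariant maps\<close>

definition topological_group :: "('g, 'm) monoid_scheme \<Rightarrow> 'g topology \<Rightarrow> bool" where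
  "topological_group G T \<longleftrightarrow>
     group G \<and> topspace T = carrier G \<and> Hausdorff_space T \<and>
     continuous_map (prod_topology T T) T (\<lambda>(g, h). g \<otimes>\<^bsub>G\<^esub> h) \<and>
     continuous_map T T (\<lambda>g. inv\<^bsub>G\<^esub> g)"

definition G_space ::
  "('g, 'm) monoid_scheme \<Rightarrow> 'g topology \<Rightarrow> 'x topology \<Rightarrow> ('g \<Rightarrow> 'x \<Rightarrow> 'x) \<Rightarrow> bool" where
  "G_space G T X \<phi> \<longleftrightarrow>
     Hausdorff_space X \<and>
     continuous_map (prod_topology T X) X (\<lambda>(g, x). \<phi> g x) \<and>
     (\<forall>x \<in> topspace X. \<phi> \<one>\<^bsub>G\<^esub> x = x) \<and>
     (\<forall>g \<in> carrier G. \<forall>h \<in> carrier G. \<forall>x \<in> topspace X. \<phi> (g \<otimes>\<^bsub>G\<^esub> h) x = \<phi> g (\<phi> h x))"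

definition G_map ::
  "('g, 'm) monoid_scheme \<Rightarrow> 'x topology \<Rightarrow> ('g \<Rightarrow> 'x \<Rightarrow> 'x) \<Rightarrow>
     'y topology \<Rightarrow> ('g \<Rightarrow> 'y \<Rightarrow> 'y) \<Rightarrow> ('x \<Rightarrow> 'y) \<Rightarrow> bool" where
  "G_map G X \<phi> Y \<psi> f \<longleftrightarrow>
     continuous_map X Y f \<and>
     (\<forall>g \<in> carrier G. \<forall>x \<in> topspace X. f (\<phi> g x) = \<psi> g (f x))"

text \<open>Homotopies are parametrized by \<open>I \<times> X\<close>, as in the library.\<close>

definition cylinder_action :: "('g \<Rightarrow> 'x \<Rightarrow> 'x) \<Rightarrow> 'g \<Rightarrow> real \<times> 'x \<Rightarrow> real \<times> 'x" where
  "cylinder_action \<phi> g = (\<lambda>(t, x). (t, \<phi> g x))"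

definition G_homotopic ::
  "('g, 'm) monoid_scheme \<Rightarrow> 'x topology \<Rightarrow> ('g \<Rightarrow> 'x \<Rightarrow> 'x) \<Rightarrow>
     'y topology \<Rightarrow> ('g \<Rightarrow> 'y \<Rightarrow> 'y) \<Rightarrow> ('x \<Rightarrow> 'y) \<Rightarrow> ('x \<Rightarrow> 'y) \<Rightarrow> bool" where
  "G_homotopic G X \<phi> Y \<psi> f f' \<longleftrightarrow>
     (\<exists>H. G_map G (prod_topology unit_interval X) (cylinder_action \<phi>) Y \<psi> H \<and>
          (\<forall>x \<in> topspace X. H (0, x) = f x \<and> H (1, x) = f' x))"

definition G_homotopy_lifting ::
  "('g, 'm) monoid_scheme \<Rightarrow> 'e topology \<Rightarrow> ('g \<Rightarrow> 'e \<Rightarrow> 'e) \<Rightarrow>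
     'b topology \<Rightarrow> ('g \<Rightarrow> 'b \<Rightarrow> 'b) \<Rightarrow> ('e \<Rightarrow> 'b) \<Rightarrow>
     'x topology \<Rightarrow> ('g \<Rightarrow> 'x \<Rightarrow> 'x) \<Rightarrow> bool" where
  "G_homotopy_lifting G E \<phi> B \<psi> p X \<xi> \<longleftrightarrow>
     (\<forall>f H. G_map G X \<xi> E \<phi> f \<and>
            G_map G (prod_topology unit_interval X) (cylinder_action \<xi>) B \<psi> H \<and>
            (\<forall>x \<in> topspace X. H (0, x) = p (f x)) \<longrightarrow>
        (\<exists>K. G_map G (prod_topology unit_interval X) (cylinder_action \<xi>) E \<phi> K \<and>
             (\<forall>x \<in> topspace X. K (0, x) = f x) \<and>
             (\<forall>t \<in> {0..1}. \<forall>x \<in> topspace X. p (K (t, x)) = H (t, x))))"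

text \<open>
  The homotopy lifting property is required for every \<open>G\<close>-space. A quantifier inside a formula
  cannot range over types, so it ranges over the \<open>G\<close>-spaces on one type, which contains the
  mapping path space of \<open>p\<close>. This is no restriction: lifting for \<open>G\<close>-spaces over arbitrary
  types is the lemma \<open>G_fibration_lifting\<close> below.
\<close>

definition G_fibration ::
  "('g, 'm) monoid_scheme \<Rightarrow> 'g topology \<Rightarrow> 'e topology \<Rightarrow> ('g \<Rightarrow> 'e \<Rightarrow> 'e) \<Rightarrow>
     'b topology \<Rightarrow> ('g \<Rightarrow> 'b \<Rightarrow> 'b) \<Rightarrow> ('e \<Rightarrow> 'b) \<Rightarrow> bool" where
  "G_fibration G T E \<phi> B \<psi> p \<longleftrightarrow>
     G_space G T E \<phi> \<and> G_space G T B \<psi> \<and> G_map G E \<phi> B \<psi> p \<and>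
     (\<forall>(X :: ('e \<times> (real \<Rightarrow> 'b)) topology) \<xi>.
        G_space G T X \<xi> \<longrightarrow> G_homotopy_lifting G E \<phi> B \<psi> p X \<xi>)"

subsection \<open>Fibrations lift homotopies on spaces of any type\<close>

lemma topspace_compact_open:
  "topspace (compact_open X Y) = {f \<in> extensional (topspace X). continuous_map X Y f}"
proof -
  have "{f \<in> extensional (topspace X). continuous_map X Y f} \<in>
     {{f \<in> extensional (topspace X). continuous_map X Y f \<and> f ` K \<subseteq> U} | K U.
        compactin X K \<and> openin Y U}"
    by (rule CollectI, rule exI[of _ "{}"], rule exI[of _ "{}"]) auto
  then show ?thesis
    unfolding compact_open_def topology_generated_by_topspace by blast
qed

lemma continuous_map_curry:
  assumes F: "continuous_map (prod_topology unit_interval X) B F"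
  shows "continuous_map X (compact_open unit_interval B) (\<lambda>x. \<lambda>t\<in>{0..1}. F (t, x))"
proof -
  have c: "continuous_map unit_interval B (\<lambda>t\<in>{0..1}. F (t, x))" if "x \<in> topspace X" for x
  proof -
    have "continuous_map unit_interval B (F \<circ> (\<lambda>t. (t, x)))"
      by (rule continuous_map_compose[OF _ F]) (simp add: continuous_map_pairwise o_def that)
    then show ?thesis
      by (rule continuous_map_eq) auto
  qed
  show ?thesis
    unfolding compact_open_def
  proof (rule continuous_on_generated_topo)
    fix S assume "S \<in> {{f \<in> extensional (topspace unit_interval). continuous_map unit_interval B f \<and> f ` K \<subseteq> U} | K U.
        compactin unit_interval K \<and> openin B U}"
    then obtain K U where S: "S = {f \<in> extensional {0..1}. continuous_map unit_interval B f \<and> f ` K \<subseteq> U}"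
      and K: "compactin unit_interval K" and U: "openin B U" by auto
    have K01: "K \<subseteq> {0..1}" using K compactin_subset_topspace by force
    define W where "W = {z \<in> topspace (prod_topology unit_interval X). F z \<in> U}"
    have W: "openin (prod_topology unit_interval X) W"
      unfolding W_def using F U by (rule openin_continuous_map_preimage)
    have eq: "((\<lambda>x. \<lambda>t\<in>{0..1}. F (t, x)) -` S \<inter> topspace X) = {x \<in> topspace X. K \<times> {x} \<subseteq> W}"
      proof (rule Set.set_eqI)
      fix x
      have "(\<lambda>t\<in>{0..1}. F (t, x)) ` K = (\<lambda>t. F (t, x)) ` K"
        using K01 by (intro image_cong) auto
      then show "x \<in> (\<lambda>x. \<lambda>t\<in>{0..1}. F (t, x)) -` S \<inter> topspace X \<longleftrightarrow>
          x \<in> {x \<in> topspace X. K \<times> {x} \<subseteq> W}"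
        using K01 c[of x] by (simp add: S W_def image_subset_iff subset_iff) blast
    qed
    show "openin X ((\<lambda>x. \<lambda>t\<in>{0..1}. F (t, x)) -` S \<inter> topspace X)"
      unfolding eq
    proof (subst openin_subopen, clarify)
      fix x assume x: "x \<in> topspace X" "K \<times> {x} \<subseteq> W"
      obtain A V where "openin X V" "K \<subseteq> A" "x \<in> V" "A \<times> V \<subseteq> W"
        using tube_lemma_left[OF W K x] by metis
      moreover from this have "V \<subseteq> topspace X"
        by (simp add: openin_subset)
      ultimately show "\<exists>T. openin X T \<and> x \<in> T \<and> T \<subseteq> {x \<in> topspace X. K \<times> {x} \<subseteq> W}"
        by (intro exI[of _ V]) auto
    qed
  next
    have "(\<lambda>x. \<lambda>t\<in>{0..1}. F (t, x)) ` topspace X \<subseteq> topspace (compact_open unit_interval B)"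
      unfolding topspace_compact_open using c by auto
    then show "(\<lambda>x. \<lambda>t\<in>{0..1}. F (t, x)) ` topspace X \<subseteq>
       \<Union> {{f \<in> extensional (topspace unit_interval). continuous_map unit_interval B f \<and> f ` K \<subseteq> U} | K U.
        compactin unit_interval K \<and> openin B U}"
      unfolding compact_open_def topology_generated_by_topspace .
  qed
qed

lemma continuous_map_path_eval:
  "continuous_map (prod_topology unit_interval (compact_open unit_interval B)) B (\<lambda>(t, w). w t)"
proof -
  let ?P = "prod_topology unit_interval (compact_open unit_interval B)"
  have "openin ?P {z \<in> topspace ?P. (\<lambda>(t, w). w t) z \<in> U}" if U: "openin B U" for U
  proof (subst openin_subopen, clarify)
    fix t w assume tw: "(t, w) \<in> topspace ?P" "w t \<in> U"
    then have t: "t \<in> {0..1}" and w: "w \<in> extensional {0..1}" "continuous_map unit_interval B w"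
      by (auto simp: topspace_compact_open)
    have "openin unit_interval {s \<in> topspace unit_interval. w s \<in> U}"
      using w(2) U by (rule openin_continuous_map_preimage)
    then obtain e where e: "e > 0" "\<And>s. s \<in> {0..1} \<Longrightarrow> dist s t < e \<Longrightarrow> w s \<in> U"
    proof -
      have "t \<in> {s \<in> topspace unit_interval. w s \<in> U}"
        using t tw(2) by simp
      then have "\<exists>e>0. \<forall>s\<in>{0..1}. dist s t < e \<longrightarrow> s \<in> {s \<in> topspace unit_interval. w s \<in> U}"
        using \<open>openin unit_interval {s \<in> topspace unit_interval. w s \<in> U}\<close>
        unfolding openin_euclidean_subtopology_iff by blast
      then show ?thesis
        using that by auto
    qed
    define K where "K = cball t (e/2) \<inter> {0..1}"
    define V where "V = ball t (e/2) \<inter> {0..1}"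
    define Q where "Q = {f \<in> extensional (topspace unit_interval). continuous_map unit_interval B f \<and> f ` K \<subseteq> U}"
    have K: "compactin unit_interval K"
      by (simp add: K_def compactin_subtopology compact_Int_closed)
    have "openin (compact_open unit_interval B) Q"
      unfolding compact_open_def by (rule topology_generated_by_Basis) (use K U Q_def in blast)
    moreover have "openin unit_interval V"
      unfolding V_def by (metis inf_commute open_ball openin_open_Int)
    ultimately have "openin ?P (V \<times> Q)" by (simp add: openin_prod_Times_iff)
    moreover have "(t, w) \<in> V \<times> Q"
      using t w e by (auto simp: V_def Q_def K_def dist_commute)
    moreover have "V \<times> Q \<subseteq> {z \<in> topspace ?P. (\<lambda>(t, w). w t) z \<in> U}"
      by (auto simp: V_def Q_def K_def topspace_compact_open)
    ultimately show "\<exists>T. openin ?P T \<and> (t, w) \<in> T \<and> T \<subseteq> {z \<in> topspace ?P. (\<lambda>(t, w). w t) z \<in> U}"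
      by blast
  qed
  moreover have "(\<lambda>(t, w). w t) \<in> topspace ?P \<rightarrow> topspace B"
    by (auto simp: topspace_compact_open continuous_map_def Pi_iff)
  ultimately show ?thesis
    by (auto simp: continuous_map_def)
qed

lemma Hausdorff_space_path_space:
  assumes "Hausdorff_space B"
  shows "Hausdorff_space (compact_open unit_interval B)"
proof -
  let ?C = "compact_open unit_interval B"
  have ev: "continuous_map ?C B (\<lambda>w. w t)" if "t \<in> {0..1}" for t
  proof -
    have "continuous_map ?C B ((\<lambda>(t, w). w t) \<circ> (\<lambda>w. (t, w)))"
      by (rule continuous_map_compose[OF _ continuous_map_path_eval])
        (use that in \<open>simp add: continuous_map_pairwise o_def\<close>)
    then show ?thesis by (simp add: o_def)
  qed
  show ?thesis
    unfolding Hausdorff_space_def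
  proof (intro allI impI, elim conjE)
    fix v w assume vw: "v \<in> topspace ?C" "w \<in> topspace ?C" "v \<noteq> w"
    then have "v \<in> extensional {0..1}" "w \<in> extensional {0..1}"
      by (auto simp: topspace_compact_open)
    with vw(3) obtain t where t: "t \<in> {0..1}" "v t \<noteq> w t"
      using extensionalityI[of v "{0..1}" w] by blast
    have "v t \<in> topspace B" "w t \<in> topspace B"
      using ev[OF t(1)] vw by (auto simp: continuous_map_def)
    then obtain U V where UV: "openin B U" "openin B V" "v t \<in> U" "w t \<in> V" "disjnt U V"
      using assms t(2) unfolding Hausdorff_space_def by blast
    show "\<exists>U V. openin ?C U \<and> openin ?C V \<and> v \<in> U \<and> w \<in> V \<and> disjnt U V"
      using openin_continuous_map_preimage[OF ev[OF t(1)] UV(1)]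
        openin_continuous_map_preimage[OF ev[OF t(1)] UV(2)] UV vw
      by (intro exI[of _ "{x \<in> topspace ?C. x t \<in> U}"] exI[of _ "{x \<in> topspace ?C. x t \<in> V}"])
         (auto simp: disjnt_iff)
  qed
qed

lemma G_fibration_lifting:
  fixes X :: "'x topology" and B :: "'b topology" and E :: "'e topology"
  assumes G: "topological_group G T" and fib: "G_fibration G T E \<phi> B \<psi> p"
    and X: "G_space G T X \<xi>"
  shows "G_homotopy_lifting G E \<phi> B \<psi> p X \<xi>"
  unfolding G_homotopy_lifting_def
proof (intro allI impI, elim conjE)
  fix f H
  assume f: "G_map G X \<xi> E \<phi> f"
    and H: "G_map G (prod_topology unit_interval X) (cylinder_action \<xi>) B \<psi> H"
    and H0: "\<forall>x \<in> topspace X. H (0, x) = p (f x)"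
  have E: "G_space G T E \<phi>" and B: "G_space G T B \<psi>" and p: "G_map G E \<phi> B \<psi> p"
    using fib by (auto simp: G_fibration_def)
  have T: "topspace T = carrier G" and grp: "group G" using G by (auto simp: topological_group_def)
  have cE: "continuous_map (prod_topology T E) E (\<lambda>(g, x). \<phi> g x)"
    and cB: "continuous_map (prod_topology T B) B (\<lambda>(g, x). \<psi> g x)"
    using E B by (auto simp: G_space_def)
  have inE: "\<phi> g x \<in> topspace E" if "g \<in> carrier G" "x \<in> topspace E" for g x
    using cE that T by (auto simp: continuous_map_def Pi_iff)
  have inB: "\<psi> g x \<in> topspace B" if "g \<in> carrier G" "x \<in> topspace B" for g x
    using cB that T by (auto simp: continuous_map_def Pi_iff)
  let ?C = "compact_open unit_interval B"
  define N where "N = subtopology (prod_topology E ?C) {(e, w). w 0 = p e}"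
  define \<nu> where "\<nu> = (\<lambda>g (e, w). (\<phi> g e, \<lambda>t\<in>{0..1::real}. \<psi> g (w t)))"
  have wB: "w t \<in> topspace B" if "(e, w) \<in> topspace N" "t \<in> {0..1}" for e w t
    using that by (auto simp: N_def topspace_compact_open continuous_map_def Pi_iff)
  have wext: "w \<in> extensional {0..1}" if "(e, w) \<in> topspace N" for e w
    using that by (auto simp: N_def topspace_compact_open)
  have eE: "e \<in> topspace E" "w 0 = p e" if "(e, w) \<in> topspace N" for e w
    using that by (auto simp: N_def)
  have cN: "continuous_map (prod_topology T N) N (\<lambda>(g, x). \<nu> g x)"
  proof -
    have s: "continuous_map (prod_topology T N) T fst" "continuous_map (prod_topology T N) N snd"
      by (auto intro: continuous_map_fst continuous_map_snd)
    have n: "continuous_map N E fst" "continuous_map N ?C snd"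
      unfolding N_def by (auto intro: continuous_map_from_subtopology continuous_map_fst continuous_map_snd)
    have a: "continuous_map (prod_topology T N) E ((\<lambda>(g, x). \<phi> g x) \<circ> (\<lambda>z. (fst z, fst (snd z))))"
      by (rule continuous_map_compose[OF _ cE])
        (simp add: continuous_map_pairwise o_def s continuous_map_compose[OF s(2) n(1), unfolded o_def])
    have b: "continuous_map (prod_topology unit_interval (prod_topology T N)) B
        ((\<lambda>(g, x). \<psi> g x) \<circ> (\<lambda>z. (fst (snd z), (\<lambda>(t, w). w t) (fst z, snd (snd (snd z))))))"
    proof (rule continuous_map_compose[OF _ cB])
      let ?P = "prod_topology unit_interval (prod_topology T N)"
      have 1: "continuous_map ?P T (\<lambda>z. fst (snd z))"
        using continuous_map_compose[OF continuous_map_snd s(1)] by (simp add: o_def)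
      have 2: "continuous_map ?P ?C (\<lambda>z. snd (snd (snd z)))"
        using continuous_map_compose[OF continuous_map_compose[OF continuous_map_snd s(2)] n(2)]
        by (simp add: o_def)
      have 3: "continuous_map ?P B ((\<lambda>(t, w). w t) \<circ> (\<lambda>z. (fst z, snd (snd (snd z)))))"
        by (rule continuous_map_compose[OF _ continuous_map_path_eval])
          (use 2 in \<open>simp add: continuous_map_pairwise o_def continuous_map_fst\<close>)
      show "continuous_map ?P (prod_topology T B)
          (\<lambda>z. (fst (snd z), (\<lambda>(t, w). w t) (fst z, snd (snd (snd z)))))"
        using 1 3 by (simp add: continuous_map_pairwise o_def)
    qed
    have b': "continuous_map (prod_topology T N) ?C (\<lambda>x. \<lambda>t\<in>{0..1}. \<psi> (fst x) (snd (snd x) t))"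
      using continuous_map_curry[OF b] by (simp add: o_def)
    have "continuous_map (prod_topology T N) (prod_topology E ?C) (\<lambda>(g, x). \<nu> g x)"
      using a b' by (simp add: continuous_map_pairwise o_def \<nu>_def case_prod_beta)
    moreover have "(\<lambda>(g, x). \<nu> g x) \<in> topspace (prod_topology T N) \<rightarrow> {(e, w). w 0 = p e}"
      using p T eE by (auto simp: \<nu>_def G_map_def)
    ultimately show ?thesis
      by (simp add: N_def continuous_map_in_subtopology)
  qed
  have N: "G_space G T N \<nu>"
    unfolding G_space_def
  proof (intro conjI ballI cN)
    show "Hausdorff_space N"
      unfolding N_def using E B
      by (intro Hausdorff_space_subtopology)
        (simp add: Hausdorff_space_prod_topology Hausdorff_space_path_space G_space_def)
    fix x assume "x \<in> topspace N"
    then obtain e w where x: "x = (e, w)" "(e, w) \<in> topspace N" by (cases x) auto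
    show "\<nu> \<one>\<^bsub>G\<^esub> x = x"
      using E B wB[OF x(2)] wext[OF x(2)] eE[OF x(2)]
      by (auto simp: \<nu>_def x(1) G_space_def intro!: extensionalityI[where A="{0..1}"])
    fix g h assume gh: "g \<in> carrier G" "h \<in> carrier G"
    show "\<nu> (g \<otimes>\<^bsub>G\<^esub> h) x = \<nu> g (\<nu> h x)"
      using E B gh wB[OF x(2)] eE[OF x(2)]
      by (auto simp: \<nu>_def x(1) G_space_def intro!: restrict_ext)
  qed
  define F where "F = (\<lambda>x. (f x, \<lambda>t\<in>{0..1}. H (t, x)))"
  have cH: "continuous_map (prod_topology unit_interval X) B H" using H by (simp add: G_map_def)
  have cF: "continuous_map X N F"
    unfolding N_def continuous_map_in_subtopology
    using f continuous_map_curry[OF cH] H0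
    by (auto simp: F_def G_map_def continuous_map_pairwise o_def)
  have inX: "\<xi> g x \<in> topspace X" if "g \<in> carrier G" "x \<in> topspace X" for g x
    using X that T by (auto simp: G_space_def continuous_map_def Pi_iff)
  have eF: "F (\<xi> g x) = \<nu> g (F x)" if "g \<in> carrier G" "x \<in> topspace X" for g x
    using f H that
    by (auto simp: F_def \<nu>_def G_map_def cylinder_action_def intro!: restrict_ext)
  define ev where "ev = (\<lambda>z::real \<times> 'e \<times> (real \<Rightarrow> 'b). snd (snd z) (fst z))"
  have cev: "continuous_map (prod_topology unit_interval N) B ev"
  proof -
    have n: "continuous_map N ?C snd"
      unfolding N_def by (auto intro: continuous_map_from_subtopology continuous_map_snd)
    have "continuous_map (prod_topology unit_interval N) B ((\<lambda>(t, w). w t) \<circ> (\<lambda>z. (fst z, snd (snd z))))"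
      by (rule continuous_map_compose[OF _ continuous_map_path_eval])
        (use continuous_map_compose[OF continuous_map_snd n] in
          \<open>simp add: continuous_map_pairwise o_def continuous_map_fst\<close>)
    then show ?thesis by (simp add: ev_def o_def)
  qed
  have mev: "G_map G (prod_topology unit_interval N) (cylinder_action \<nu>) B \<psi> ev"
    using cev by (auto simp: G_map_def ev_def cylinder_action_def \<nu>_def)
  have mfst: "G_map G N \<nu> E \<phi> fst"
    unfolding G_map_def N_def
    by (auto intro: continuous_map_from_subtopology continuous_map_fst simp: \<nu>_def)
  have "G_homotopy_lifting G E \<phi> B \<psi> p N \<nu>"
    using fib N by (auto simp: G_fibration_def)
  moreover have "\<forall>x \<in> topspace N. ev (0, x) = p (fst x)"
    using eE by (auto simp: ev_def)
  ultimately obtain K where K: "G_map G (prod_topology unit_interval N) (cylinder_action \<nu>) E \<phi> K"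
    "\<forall>x \<in> topspace N. K (0, x) = fst x"
    "\<forall>t \<in> {0..1}. \<forall>x \<in> topspace N. p (K (t, x)) = ev (t, x)"
    using mev mfst unfolding G_homotopy_lifting_def by blast
  have Fin: "F x \<in> topspace N" if "x \<in> topspace X" for x
    using cF that by (auto simp: continuous_map_def)
  let ?K = "\<lambda>z. K (fst z, F (snd z))"
  have "continuous_map (prod_topology unit_interval X) E (K \<circ> (\<lambda>z. (fst z, F (snd z))))"
    by (rule continuous_map_compose[where X' = "prod_topology unit_interval N"])
      (use K(1) continuous_map_compose[OF continuous_map_snd cF] in
        \<open>simp_all add: G_map_def continuous_map_pairwise o_def continuous_map_fst\<close>)
  then have "G_map G (prod_topology unit_interval X) (cylinder_action \<xi>) E \<phi> ?K"
    using K(1) Fin eF by (auto simp: G_map_def o_def cylinder_action_def)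
  moreover have "\<forall>x \<in> topspace X. ?K (0, x) = f x"
    using K(2) Fin by (simp add: F_def)
  moreover have "\<forall>t \<in> {0..1}. \<forall>x \<in> topspace X. p (?K (t, x)) = H (t, x)"
    using K(3) Fin by (simp add: ev_def F_def)
  ultimately show "\<exists>K. G_map G (prod_topology unit_interval X) (cylinder_action \<xi>) E \<phi> K \<and>
             (\<forall>x \<in> topspace X. K (0, x) = f x) \<and>
             (\<forall>t \<in> {0..1}. \<forall>x \<in> topspace X. p (K (t, x)) = H (t, x))"
    by blast
qed


section \<open>Equivariant sectional category\<close>

definition secat ::
  "('g, 'm) monoid_scheme \<Rightarrow> 'x topology \<Rightarrow> ('g \<Rightarrow> 'x \<Rightarrow> 'x) \<Rightarrow>
     'y topology \<Rightarrow> ('g \<Rightarrow> 'y \<Rightarrow> 'y) \<Rightarrow> ('x \<Rightarrow> 'y) \<Rightarrow> enat" where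
  "secat G X \<phi> Y \<psi> q =
     Inf {enat k | k. 1 \<le> k \<and>
       (\<exists>U. topspace Y = (\<Union>i\<in>{1..k}. U i) \<and>
          (\<forall>i\<in>{1..k}. openin Y (U i) \<and> (\<forall>g \<in> carrier G. \<psi> g ` U i \<subseteq> U i) \<and>
             (\<exists>s. G_map G (subtopology Y (U i)) \<psi> X \<phi> s \<and>
                  G_homotopic G (subtopology Y (U i)) \<psi> Y \<psi> (q \<circ> s) id)))}"


section \<open>Invariant parametrized topological complexity\<close>

definition product_action ::
  "('g \<Rightarrow> 'x \<Rightarrow> 'x) \<Rightarrow> ('h \<Rightarrow> 'y \<Rightarrow> 'y) \<Rightarrow> 'g \<times> 'h \<Rightarrow> 'x \<times> 'y \<Rightarrow> 'x \<times> 'y" where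
  "product_action \<phi> \<psi> = (\<lambda>(g, h) (x, y). (\<phi> g x, \<psi> h y))"

definition path_action :: "('g \<Rightarrow> 'e \<Rightarrow> 'e) \<Rightarrow> 'g \<Rightarrow> (real \<Rightarrow> 'e) \<Rightarrow> (real \<Rightarrow> 'e)" where
  "path_action \<phi> g \<gamma> = (\<lambda>t\<in>{0..1}. \<phi> g (\<gamma> t))"

definition fibrewise_paths ::
  "'e topology \<Rightarrow> 'b topology \<Rightarrow> ('e \<Rightarrow> 'b) \<Rightarrow> (real \<Rightarrow> 'e) topology" where
  "fibrewise_paths E B p =
     subtopology (compact_open unit_interval E)
       {\<gamma>. \<exists>b \<in> topspace B. \<forall>t \<in> {0..1}. p (\<gamma> t) = b}"

definition fibrewise_path_pairs ::
  "('g, 'm) monoid_scheme \<Rightarrow> 'e topology \<Rightarrow> ('g \<Rightarrow> 'e \<Rightarrow> 'e) \<Rightarrow> 'b topology \<Rightarrow>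
     ('e \<Rightarrow> 'b) \<Rightarrow> ((real \<Rightarrow> 'e) \<times> (real \<Rightarrow> 'e)) topology" where
  "fibrewise_path_pairs G E \<phi> B p =
     subtopology (prod_topology (fibrewise_paths E B p) (fibrewise_paths E B p))
       {(\<gamma>, \<delta>). orbit G \<phi> (\<gamma> 1) = orbit G \<phi> (\<delta> 0)}"

definition pairs_over_base_orbits ::
  "('g, 'm) monoid_scheme \<Rightarrow> 'e topology \<Rightarrow> ('g \<Rightarrow> 'b \<Rightarrow> 'b) \<Rightarrow> ('e \<Rightarrow> 'b) \<Rightarrow>
     ('e \<times> 'e) topology" where
  "pairs_over_base_orbits G E \<psi> p =
     subtopology (prod_topology E E) {(e1, e2). orbit G \<psi> (p e1) = orbit G \<psi> (p e2)}"

definition pairs_over_orbits ::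
  "('g, 'm) monoid_scheme \<Rightarrow> 'e topology \<Rightarrow> ('g \<Rightarrow> 'e \<Rightarrow> 'e) \<Rightarrow> ('e \<times> 'e) topology" where
  "pairs_over_orbits G E \<phi> =
     subtopology (prod_topology E E) {(e1, e2). orbit G \<phi> e1 = orbit G \<phi> e2}"

definition endpoint_map :: "(real \<Rightarrow> 'e) \<times> (real \<Rightarrow> 'e) \<Rightarrow> 'e \<times> 'e" where
  "endpoint_map = (\<lambda>(\<gamma>, \<delta>). (\<gamma> 0, \<delta> 1))"

definition invariant_param_TC ::
  "('g, 'm) monoid_scheme \<Rightarrow> 'e topology \<Rightarrow> ('g \<Rightarrow> 'e \<Rightarrow> 'e) \<Rightarrow>
     'b topology \<Rightarrow> ('g \<Rightarrow> 'b \<Rightarrow> 'b) \<Rightarrow> ('e \<Rightarrow> 'b) \<Rightarrow> enat" where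
  "invariant_param_TC G E \<phi> B \<psi> p =
     secat (G \<times>\<times> G)
       (fibrewise_path_pairs G E \<phi> B p) (product_action (path_action \<phi>) (path_action \<phi>))
       (pairs_over_base_orbits G E \<psi> p) (product_action \<phi> \<phi>)
       endpoint_map"


section \<open>Singular cohomology ring\<close>

text \<open>
  A cochain is inhomogeneous: it assigns to every degree \<open>n\<close> a function on the singular
  \<open>n\<close>-simplices, extended by zero to all other functions, and it vanishes in all but finitely
  many degrees. Thus \<open>singular_cohomology X\<close> is the direct sum of the \<open>H\<^sup>n(X;R)\<close>, where the
  commutative ring \<open>R\<close> is the type \<open>'r\<close>.
\<close>

type_synonym ('a, 'r) cochain = "nat \<Rightarrow> ((nat \<Rightarrow> real) \<Rightarrow> 'a) \<Rightarrow> 'r"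

definition singular_cochains :: "'a topology \<Rightarrow> ('a, 'r::comm_ring_1) cochain set" where
  "singular_cochains X =
     {c. (\<forall>n \<sigma>. \<not> singular_simplex n X \<sigma> \<longrightarrow> c n \<sigma> = 0) \<and> finite {n. c n \<noteq> (\<lambda>\<sigma>. 0)}}"

definition cochain_differential ::
  "'a topology \<Rightarrow> ('a, 'r::comm_ring_1) cochain \<Rightarrow> ('a, 'r) cochain" where
  "cochain_differential X c = (\<lambda>n \<sigma>.
     if n \<noteq> 0 \<and> singular_simplex n X \<sigma>
     then (\<Sum>k\<le>n. (-1) ^ k * c (n - 1) (singular_face n k \<sigma>)) else 0)"

definition front_face :: "nat \<Rightarrow> ((nat \<Rightarrow> real) \<Rightarrow> 'a) \<Rightarrow> (nat \<Rightarrow> real) \<Rightarrow> 'a" where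
  "front_face m \<sigma> = restrict \<sigma> (standard_simplex m)"

text \<open>The last \<open>n\<close>-dimensional face of an \<open>(m + n)\<close>-simplex, on the vertices \<open>m, \<dots>, m + n\<close>.\<close>

definition back_face :: "nat \<Rightarrow> nat \<Rightarrow> ((nat \<Rightarrow> real) \<Rightarrow> 'a) \<Rightarrow> (nat \<Rightarrow> real) \<Rightarrow> 'a" where
  "back_face m n \<sigma> =
     restrict (\<lambda>x. \<sigma> (\<lambda>i. if i < m then 0 else x (i - m))) (standard_simplex n)"

definition cup_cochain ::
  "'a topology \<Rightarrow> ('a, 'r::comm_ring_1) cochain \<Rightarrow> ('a, 'r) cochain \<Rightarrow> ('a, 'r) cochain" where
  "cup_cochain X c d = (\<lambda>n \<sigma>.
     if singular_simplex n X \<sigma>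
     then (\<Sum>m\<le>n. c m (front_face m \<sigma>) * d (n - m) (back_face m (n - m) \<sigma>)) else 0)"

definition cocycle_ring :: "'a topology \<Rightarrow> ('a, 'r::comm_ring_1) cochain ring" where
  "cocycle_ring X =
     \<lparr>carrier = {c \<in> singular_cochains X. cochain_differential X c = (\<lambda>n \<sigma>. 0)},
      mult = cup_cochain X,
      one = (\<lambda>n \<sigma>. if n = 0 \<and> singular_simplex 0 X \<sigma> then 1 else 0),
      zero = (\<lambda>n \<sigma>. 0),
      add = (\<lambda>c d n \<sigma>. c n \<sigma> + d n \<sigma>)\<rparr>"

definition coboundaries :: "'a topology \<Rightarrow> ('a, 'r::comm_ring_1) cochain set" where
  "coboundaries X = cochain_differential X ` singular_cochains X"

definition singular_cohomology :: "'a topology \<Rightarrow> ('a, 'r::comm_ring_1) cochain set ring" where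
  "singular_cohomology X = cocycle_ring X Quot coboundaries X"

definition cochain_pullback ::
  "'a topology \<Rightarrow> ('a \<Rightarrow> 'b) \<Rightarrow> ('b, 'r::comm_ring_1) cochain \<Rightarrow> ('a, 'r) cochain" where
  "cochain_pullback X f c = (\<lambda>n \<sigma>.
     if singular_simplex n X \<sigma> then c n (simplex_map n f \<sigma>) else 0)"

text \<open>
  As in \<^const>\<open>rcoset_mult\<close>, the union runs over the cocycles representing the class; they all
  give the same coset when \<open>f\<close> is a continuous map defined on \<open>X\<close>.
\<close>

definition cohomology_map ::
  "'a topology \<Rightarrow> ('a \<Rightarrow> 'b) \<Rightarrow> ('b, 'r::comm_ring_1) cochain set \<Rightarrow> ('a, 'r) cochain set" where
  "cohomology_map X f u =
     (\<Union>c\<in>u. coboundaries X +>\<^bsub>cocycle_ring X\<^esub> cochain_pullback X f c)"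

text \<open>
  Reduced cohomology with respect to a base point \<open>x0\<close>, as the kernel of the restriction to
  \<open>{x0}\<close>. This is an ideal, so that cup products of reduced classes are defined; it contains
  all classes of positive degree.
\<close>

definition reduced_cohomology ::
  "'a topology \<Rightarrow> 'a \<Rightarrow> ('a, 'r::comm_ring_1) cochain set set" where
  "reduced_cohomology X x0 =
     {u \<in> carrier (singular_cohomology X).
        cohomology_map (subtopology X {x0}) (\<lambda>x. x) u =
          \<zero>\<^bsub>singular_cohomology (subtopology X {x0})\<^esub>}"


section \<open>Universal principal bundles and homotopy orbit spaces\<close>

definition principal_bundle ::
  "('g, 'm) monoid_scheme \<Rightarrow> 'g topology \<Rightarrow> 'z topology \<Rightarrow> ('z \<Rightarrow> 'g \<Rightarrow> 'z) \<Rightarrow>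
     'w topology \<Rightarrow> ('z \<Rightarrow> 'w) \<Rightarrow> bool" where
  "principal_bundle \<Gamma> T P \<rho> W \<pi> \<longleftrightarrow>
     Hausdorff_space P \<and> Hausdorff_space W \<and>
     continuous_map (prod_topology P T) P (\<lambda>(e, g). \<rho> e g) \<and>
     (\<forall>e \<in> topspace P. \<rho> e \<one>\<^bsub>\<Gamma>\<^esub> = e) \<and>
     (\<forall>e \<in> topspace P. \<forall>g \<in> carrier \<Gamma>. \<forall>h \<in> carrier \<Gamma>. \<rho> e (g \<otimes>\<^bsub>\<Gamma>\<^esub> h) = \<rho> (\<rho> e g) h) \<and>
     continuous_map P W \<pi> \<and>
     (\<forall>e \<in> topspace P. \<forall>g \<in> carrier \<Gamma>. \<pi> (\<rho> e g) = \<pi> e) \<and>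
     (\<forall>b \<in> topspace W. \<exists>U \<theta>. openin W U \<and> b \<in> U \<and>
        homeomorphic_map (prod_topology (subtopology W U) T)
          (subtopology P {e. \<pi> e \<in> U}) \<theta> \<and>
        (\<forall>x \<in> U. \<forall>g \<in> carrier \<Gamma>. \<pi> (\<theta> (x, g)) = x) \<and>
        (\<forall>x \<in> U. \<forall>g \<in> carrier \<Gamma>. \<forall>h \<in> carrier \<Gamma>. \<theta> (x, g \<otimes>\<^bsub>\<Gamma>\<^esub> h) = \<rho> (\<theta> (x, g)) h))"

text \<open>
  A principal bundle is called universal when its total space is contractible, as for Milnor's
  infinite join. Numerability is not demanded. The library's \<^const>\<open>contractible_space\<close> holds
  for the empty space, which has to be excluded.
\<close>

definition universal_principal_bundle ::
  "('g, 'm) monoid_scheme \<Rightarrow> 'g topology \<Rightarrow> 'z topology \<Rightarrow> ('z \<Rightarrow> 'g \<Rightarrow> 'z) \<Rightarrow>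
     'w topology \<Rightarrow> ('z \<Rightarrow> 'w) \<Rightarrow> bool" where
  "universal_principal_bundle \<Gamma> T P \<rho> W \<pi> \<longleftrightarrow>
     principal_bundle \<Gamma> T P \<rho> W \<pi> \<and> topspace P \<noteq> {} \<and> contractible_space P"

text \<open>These pairs already form an equivalence relation.\<close>

definition homotopy_orbit_rel ::
  "('g, 'm) monoid_scheme \<Rightarrow> 'z topology \<Rightarrow> ('z \<Rightarrow> 'g \<Rightarrow> 'z) \<Rightarrow>
     'x topology \<Rightarrow> ('g \<Rightarrow> 'x \<Rightarrow> 'x) \<Rightarrow> (('z \<times> 'x) \<times> ('z \<times> 'x)) set" where
  "homotopy_orbit_rel \<Gamma> P \<rho> X \<phi> =
     {((\<rho> e g, x), (e, \<phi> g x)) | e g x.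
        e \<in> topspace P \<and> g \<in> carrier \<Gamma> \<and> x \<in> topspace X}"

definition homotopy_orbit_space ::
  "('g, 'm) monoid_scheme \<Rightarrow> 'z topology \<Rightarrow> ('z \<Rightarrow> 'g \<Rightarrow> 'z) \<Rightarrow>
     'x topology \<Rightarrow> ('g \<Rightarrow> 'x \<Rightarrow> 'x) \<Rightarrow> ('z \<times> 'x) set topology" where
  "homotopy_orbit_space \<Gamma> P \<rho> X \<phi> =
     quotient_topology (prod_topology P X) (\<lambda>z. homotopy_orbit_rel \<Gamma> P \<rho> X \<phi> `` {z})"

text \<open>The map induced by an equivariant map \<open>f\<close> into the space \<open>Y\<close> with action \<open>\<psi>\<close>.\<close>

definition homotopy_orbit_map ::
  "('g, 'm) monoid_scheme \<Rightarrow> 'z topology \<Rightarrow> ('z \<Rightarrow> 'g \<Rightarrow> 'z) \<Rightarrow>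
     'y topology \<Rightarrow> ('g \<Rightarrow> 'y \<Rightarrow> 'y) \<Rightarrow> ('x \<Rightarrow> 'y) \<Rightarrow> ('z \<times> 'x) set \<Rightarrow> ('z \<times> 'y) set" where
  "homotopy_orbit_map \<Gamma> P \<rho> Y \<psi> f C =
     (\<Union>(e, x)\<in>C. homotopy_orbit_rel \<Gamma> P \<rho> Y \<psi> `` {(e, f x)})"

lemma equiv_homotopy_orbit_rel:
  assumes "topological_group \<Gamma> T" "principal_bundle \<Gamma> T P \<rho> W \<pi>" "G_space \<Gamma> T X \<phi>"
  shows "equiv (topspace (prod_topology P X)) (homotopy_orbit_rel \<Gamma> P \<rho> X \<phi>)"
proof -
  interpret group \<Gamma> using assms by (simp add: topological_group_def)
  have T: "topspace T = carrier \<Gamma>" using assms by (simp add: topological_group_def)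
  have r: "\<rho> e g \<in> topspace P" "\<phi> g x \<in> topspace X"
    if "e \<in> topspace P" "g \<in> carrier \<Gamma>" "x \<in> topspace X" for e g x
    using assms(2,3) that T by (auto simp: principal_bundle_def G_space_def continuous_map_def Pi_iff)
  have r1: "\<rho> e \<one>\<^bsub>\<Gamma>\<^esub> = e" if "e \<in> topspace P" for e
    using assms(2) that by (simp add: principal_bundle_def)
  have r2: "\<rho> (\<rho> e g) h = \<rho> e (g \<otimes>\<^bsub>\<Gamma>\<^esub> h)"
    if "e \<in> topspace P" "g \<in> carrier \<Gamma>" "h \<in> carrier \<Gamma>" for e g h
    using assms(2) that by (simp add: principal_bundle_def)
  have f1: "\<phi> \<one>\<^bsub>\<Gamma>\<^esub> x = x" if "x \<in> topspace X" for x
    using assms(3) that by (simp add: G_space_def)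
  have f2: "\<phi> g (\<phi> h x) = \<phi> (g \<otimes>\<^bsub>\<Gamma>\<^esub> h) x"
    if "x \<in> topspace X" "g \<in> carrier \<Gamma>" "h \<in> carrier \<Gamma>" for x g h
    using assms(3) that by (simp add: G_space_def)
  have iff: "((a, x), (b, y)) \<in> homotopy_orbit_rel \<Gamma> P \<rho> X \<phi> \<longleftrightarrow>
      b \<in> topspace P \<and> x \<in> topspace X \<and> (\<exists>g \<in> carrier \<Gamma>. a = \<rho> b g \<and> y = \<phi> g x)" for a b x y
    by (auto simp: homotopy_orbit_rel_def)
  show ?thesis
  proof (rule equivI)
    show "homotopy_orbit_rel \<Gamma> P \<rho> X \<phi> \<subseteq> topspace (prod_topology P X) \<times> topspace (prod_topology P X)"
      using r by (auto simp: homotopy_orbit_rel_def)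
    show "refl_on (topspace (prod_topology P X)) (homotopy_orbit_rel \<Gamma> P \<rho> X \<phi>)"
      using r by (auto simp: refl_on_def iff r1 f1 intro!: bexI[of _ "\<one>\<^bsub>\<Gamma>\<^esub>"])
    show "sym (homotopy_orbit_rel \<Gamma> P \<rho> X \<phi>)"
    proof (rule symI, clarsimp simp: iff)
      fix b x g assume h: "b \<in> topspace P" "x \<in> topspace X" "g \<in> carrier \<Gamma>"
      then show "\<rho> b g \<in> topspace P \<and> \<phi> g x \<in> topspace X \<and>
          (\<exists>h\<in>carrier \<Gamma>. b = \<rho> (\<rho> b g) h \<and> x = \<phi> h (\<phi> g x))"
        using r by (auto simp: r2 f2 r1 f1 intro!: bexI[of _ "inv\<^bsub>\<Gamma>\<^esub> g"])
    qed
    show "trans (homotopy_orbit_rel \<Gamma> P \<rho> X \<phi>)"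
    proof (rule transI, clarsimp simp: iff)
      fix b x g h assume "b \<in> topspace P" "x \<in> topspace X" "g \<in> carrier \<Gamma>" "h \<in> carrier \<Gamma>"
      then show "\<exists>k\<in>carrier \<Gamma>. \<rho> (\<rho> b h) g = \<rho> b k \<and> \<phi> h (\<phi> g x) = \<phi> k x"
        by (auto simp: r2 f2)
    qed
  qed
qed

definition borel_cohomology ::
  "('g, 'm) monoid_scheme \<Rightarrow> 'z topology \<Rightarrow> ('z \<Rightarrow> 'g \<Rightarrow> 'z) \<Rightarrow>
     'x topology \<Rightarrow> ('g \<Rightarrow> 'x \<Rightarrow> 'x) \<Rightarrow> (('z \<times> 'x) set, 'r::comm_ring_1) cochain set ring" where
  "borel_cohomology \<Gamma> P \<rho> X \<phi> = singular_cohomology (homotopy_orbit_space \<Gamma> P \<rho> X \<phi>)"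

definition reduced_borel_cohomology ::
  "('g, 'm) monoid_scheme \<Rightarrow> 'z topology \<Rightarrow> ('z \<Rightarrow> 'g \<Rightarrow> 'z) \<Rightarrow>
     'x topology \<Rightarrow> ('g \<Rightarrow> 'x \<Rightarrow> 'x) \<Rightarrow> ('z \<times> 'x) set \<Rightarrow>
     (('z \<times> 'x) set, 'r::comm_ring_1) cochain set set" where
  "reduced_borel_cohomology \<Gamma> P \<rho> X \<phi> x0 =
     reduced_cohomology (homotopy_orbit_space \<Gamma> P \<rho> X \<phi>) x0"

definition borel_cohomology_map ::
  "('g, 'm) monoid_scheme \<Rightarrow> 'z topology \<Rightarrow> ('z \<Rightarrow> 'g \<Rightarrow> 'z) \<Rightarrow>
     'x topology \<Rightarrow> ('g \<Rightarrow> 'x \<Rightarrow> 'x) \<Rightarrow> 'y topology \<Rightarrow> ('g \<Rightarrow> 'y \<Rightarrow> 'y) \<Rightarrow> ('x \<Rightarrow> 'y) \<Rightarrow>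
     (('z \<times> 'y) set, 'r::comm_ring_1) cochain set \<Rightarrow> (('z \<times> 'x) set, 'r) cochain set" where
  "borel_cohomology_map \<Gamma> P \<rho> X \<phi> Y \<psi> f =
     cohomology_map (homotopy_orbit_space \<Gamma> P \<rho> X \<phi>) (homotopy_orbit_map \<Gamma> P \<rho> Y \<psi> f)"

end

theory Submission
  imports Defs
begin

text \<open>
  Write \<open>\<Gamma> = G \<times> G\<close>, \<open>Y = E \<times>\<^bsub>B/G\<^esub> E\<close> and \<open>Z = E \<times>\<^bsub>E/G\<^esub> E\<close>. Shrinking the two paths of a pair
  \<open>(\<gamma>, \<delta>)\<close> to their inner ends deforms \<open>\<Psi>(\<gamma>, \<delta>) = (\<gamma>(0), \<delta>(1))\<close> equivariantly into
  \<open>(\<gamma>(1), \<delta>(0))\<close>, which lies in \<open>Z\<close>; the deformation stays in \<open>Y\<close> because both paths run in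
  fibres of \<open>p\<close>. So an equivariant homotopy section of \<open>\<Psi>\<close> over an invariant open set \<open>U \<subseteq> Y\<close>
  makes the inclusion of \<open>U\<close> equivariantly homotopic to a map that factors through \<open>i : Z \<rightarrow> Y\<close>.
  Passing to homotopy orbits, every class killed by \<open>(i\<^sup>h)\<^sup>*\<close> restricts to zero on the open set
  \<open>q (P \<times> U)\<close> of \<open>Y\<^sup>h\<close>, where \<open>P\<close> is the total space of the principal bundle and \<open>q\<close> the quotient
  map (\<open>restriction_to_orbit_image_bounds\<close>).

  If \<open>TC \<le> k\<close>, then at most \<open>k\<close> such sets \<open>U\<close> cover \<open>Y\<close>, and the sets \<open>q (P \<times> U)\<close> cover \<open>Y\<^sup>h\<close>; after
  repeating one of them there are exactly \<open>k\<close>, and each \<open>u\<^sub>j\<close> vanishes on the \<open>j\<close>-th. As usual this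
  forces the cup product to vanish (\<open>cup_product_of_locally_trivial_classes\<close>), against the
  assumption.

  The last step is done with cochains of the whole space. A cocycle whose restriction
  to \<open>W\<close> is a coboundary is changed by a coboundary so that it vanishes on the simplices of \<open>W\<close>. The product of such
  representatives is a cocycle that vanishes on every simplex small with respect to the cover, and
  a cocycle of this kind is a coboundary by iterated subdivision
  (\<open>cocycle_vanishing_on_small_simplices\<close>).

  Homotopy invariance is needed for cochains with values in an arbitrary ring, where knowing that
  homotopic maps agree on integral homology is not enough. A natural chain homotopy is therefore
  built by the method of acyclic models, from the fact that positive-dimensional cycles in the
  contractible spaces \<open>I \<times> \<Delta>\<^sup>n\<close> bound (\<open>prism_models_exist\<close>, \<open>cochain_pullback_homotopic\<close>).
\<close>


section \<open>Cochains as functionals on integral chains\<close>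

definition cochain_eval :: "('s \<Rightarrow> 'r::comm_ring_1) \<Rightarrow> ('s \<Rightarrow>\<^sub>0 int) \<Rightarrow> 'r" where
  "cochain_eval z c = (\<Sum>\<sigma>\<in>Poly_Mapping.keys c. of_int (Poly_Mapping.lookup c \<sigma>) * z \<sigma>)"

lemma cochain_eval_superset:
  assumes "finite A" "Poly_Mapping.keys c \<subseteq> A"
  shows "cochain_eval z c = (\<Sum>\<sigma>\<in>A. of_int (Poly_Mapping.lookup c \<sigma>) * z \<sigma>)"
  unfolding cochain_eval_def
  by (rule sum.mono_neutral_left) (use assms in \<open>auto simp: in_keys_iff\<close>)

lemma cochain_eval_0 [simp]: "cochain_eval z 0 = 0"
  by (simp add: cochain_eval_def)

lemma cochain_eval_of [simp]: "cochain_eval z (frag_of \<sigma>) = z \<sigma>"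
  by (simp add: cochain_eval_def)

lemma cochain_eval_add: "cochain_eval z (c + d) = cochain_eval z c + cochain_eval z d"
proof -
  let ?A = "Poly_Mapping.keys c \<union> Poly_Mapping.keys d"
  have "Poly_Mapping.keys (c + d) \<subseteq> ?A"
    by (rule keys_add)
  then show ?thesis
    by (simp add: cochain_eval_superset[of ?A] lookup_add distrib_right sum.distrib)
qed

lemma cochain_eval_cmul: "cochain_eval z (frag_cmul a c) = of_int a * cochain_eval z c"
  by (simp add: cochain_eval_superset[of "Poly_Mapping.keys c"] keys_cmul sum_distrib_left mult.assoc)

lemma cochain_eval_minus: "cochain_eval z (- c) = - cochain_eval z c"
  using cochain_eval_cmul[of z "-1" c] by simp

lemma cochain_eval_diff: "cochain_eval z (c - d) = cochain_eval z c - cochain_eval z d"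
  using cochain_eval_add[of z c "- d"] by (simp add: cochain_eval_minus)

lemma cochain_eval_sum: "cochain_eval z (\<Sum>i\<in>I. c i) = (\<Sum>i\<in>I. cochain_eval z (c i))"
  by (induction I rule: infinite_finite_induct) (simp_all add: cochain_eval_add)

lemma cochain_eval_extend:
  "cochain_eval z (frag_extend f c) = cochain_eval (\<lambda>\<sigma>. cochain_eval z (f \<sigma>)) c"
  by (simp add: frag_extend_def cochain_eval_sum cochain_eval_cmul cochain_eval_def[of _ c])

lemma cochain_eval_cong:
  "(\<And>\<sigma>. \<sigma> \<in> Poly_Mapping.keys c \<Longrightarrow> z \<sigma> = w \<sigma>) \<Longrightarrow> cochain_eval z c = cochain_eval w c"
  by (simp add: cochain_eval_def)

lemma cochain_eval_eq_0:
  "(\<And>\<sigma>. \<sigma> \<in> Poly_Mapping.keys c \<Longrightarrow> z \<sigma> = 0) \<Longrightarrow> cochain_eval z c = 0"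
  by (simp add: cochain_eval_def)

lemma cochain_eval_boundary_of:
  "cochain_eval z (chain_boundary (Suc n) (frag_of \<sigma>)) =
     (\<Sum>k\<le>Suc n. (-1) ^ k * z (singular_face (Suc n) k \<sigma>))"
  by (simp add: chain_boundary_of cochain_eval_sum cochain_eval_cmul del: sum.atMost_Suc)

lemma cochain_differential_Suc:
  assumes "singular_simplex (Suc n) X \<sigma>"
  shows "cochain_differential X z (Suc n) \<sigma> = cochain_eval (z n) (chain_boundary (Suc n) (frag_of \<sigma>))"
  using assms by (simp add: cochain_differential_def cochain_eval_boundary_of del: sum.atMost_Suc)

lemma cochain_differential_0 [simp]: "cochain_differential X z 0 \<sigma> = 0"
  by (simp add: cochain_differential_def)

text \<open>Evaluation on integral chains turns the coboundary into the transpose of the boundary, so that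
  chain homotopies between integral chains can be used for coefficients in any ring.\<close>

lemma cochain_eval_differential:
  assumes "singular_chain (Suc n) X c"
  shows "cochain_eval (cochain_differential X z (Suc n)) c = cochain_eval (z n) (chain_boundary (Suc n) c)"
proof -
  have "cochain_eval (cochain_differential X z (Suc n)) c =
      cochain_eval (\<lambda>\<sigma>. cochain_eval (z n) (\<Sum>k\<le>Suc n. frag_cmul ((-1) ^ k) (frag_of (singular_face (Suc n) k \<sigma>)))) c"
    using assms by (intro cochain_eval_cong)
      (auto simp: singular_chain_def cochain_differential_Suc chain_boundary_of simp del: sum.atMost_Suc)
  then show ?thesis
    by (simp add: chain_boundary_def cochain_eval_extend del: sum.atMost_Suc)
qed

definition singular_cocycles :: "'a topology \<Rightarrow> ('a, 'r::comm_ring_1) cochain set" where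
  "singular_cocycles X = {z \<in> singular_cochains X. cochain_differential X z = (\<lambda>n \<sigma>. 0)}"

lemma carrier_cocycle_ring: "carrier (cocycle_ring X) = singular_cocycles X"
  by (simp add: cocycle_ring_def singular_cocycles_def)

lemma singular_cocyclesD:
  assumes "z \<in> singular_cocycles X"
  shows "z \<in> singular_cochains X" "cochain_differential X z = (\<lambda>n \<sigma>. 0)"
  using assms by (auto simp: singular_cocycles_def)

lemma cocycle_eval_boundary:
  assumes "z \<in> singular_cocycles X" "singular_chain (Suc n) X c"
  shows "cochain_eval (z n) (chain_boundary (Suc n) c) = 0"
  using cochain_eval_differential[OF assms(2), of z] singular_cocyclesD(2)[OF assms(1)]
  by (simp add: cochain_eval_eq_0)

lemma singular_cochains_vanish:
  "z \<in> singular_cochains X \<Longrightarrow> \<not> singular_simplex n X \<sigma> \<Longrightarrow> z n \<sigma> = 0"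
  by (simp add: singular_cochains_def)

text \<open>The primitive \<open>b\<close> is only ever evaluated on simplices of \<open>X\<close>, so it may be given by a
  formula that makes sense for all functions; cutting it off outside the simplices turns it into a
  cochain. Degree \<open>0\<close> is a separate condition, as coboundaries vanish there.\<close>

lemma coboundaryI:
  fixes b :: "nat \<Rightarrow> ((nat \<Rightarrow> real) \<Rightarrow> 'a) \<Rightarrow> 'r::comm_ring_1"
  assumes z: "z \<in> singular_cochains X"
    and deg0: "\<And>\<sigma>. singular_simplex 0 X \<sigma> \<Longrightarrow> z 0 \<sigma> = 0"
    and b: "\<And>n \<sigma>. singular_simplex (Suc n) X \<sigma> \<Longrightarrow>
              cochain_eval (b n) (chain_boundary (Suc n) (frag_of \<sigma>)) = z (Suc n) \<sigma>"
    and fin: "finite {n. \<exists>\<sigma>. singular_simplex n X \<sigma> \<and> b n \<sigma> \<noteq> 0}"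
  shows "z \<in> coboundaries X"
proof -
  define e where "e = (\<lambda>n \<sigma>. if singular_simplex n X \<sigma> then b n \<sigma> else 0)"
  have "finite {n. e n \<noteq> (\<lambda>\<sigma>. 0)}"
    by (rule finite_subset[OF _ fin]) (auto simp: e_def fun_eq_iff split: if_splits)
  then have e: "e \<in> singular_cochains X"
    by (auto simp: singular_cochains_def e_def)
  have "cochain_differential X e n \<sigma> = z n \<sigma>" for n \<sigma>
  proof (cases "singular_simplex n X \<sigma>")
    case False
    then show ?thesis
      using singular_cochains_vanish[OF z False] by (simp add: cochain_differential_def)
  next
    case True
    show ?thesis
    proof (cases n)
      case 0
      then show ?thesis using deg0 True by simp
    next
      case (Suc m)
      have "singular_chain m X (chain_boundary (Suc m) (frag_of \<sigma>))"
        using True Suc by (intro singular_chain_boundary_alt) (simp add: singular_chain_of)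
      then have "cochain_eval (e m) (chain_boundary (Suc m) (frag_of \<sigma>)) =
          cochain_eval (b m) (chain_boundary (Suc m) (frag_of \<sigma>))"
        by (intro cochain_eval_cong) (auto simp: e_def singular_chain_def)
      then show ?thesis
        using b True Suc by (simp add: cochain_differential_Suc)
    qed
  qed
  then have "cochain_differential X e = z" by blast
  then show ?thesis using e by (auto simp: coboundaries_def)
qed

lemma singular_cochains_add:
  assumes "z \<in> singular_cochains X" "w \<in> singular_cochains X"
  shows "(\<lambda>n \<sigma>. z n \<sigma> + w n \<sigma>) \<in> singular_cochains X"
proof -
  have "finite ({n. z n \<noteq> (\<lambda>\<sigma>. 0)} \<union> {n. w n \<noteq> (\<lambda>\<sigma>. 0)})"
    using assms by (simp add: singular_cochains_def)
  then have "finite {n. (\<lambda>\<sigma>. z n \<sigma> + w n \<sigma>) \<noteq> (\<lambda>\<sigma>. 0)}"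
    by (rule rev_finite_subset) (auto simp: fun_eq_iff)
  then show ?thesis using assms by (simp add: singular_cochains_def)
qed

lemma singular_cochains_uminus:
  assumes "z \<in> singular_cochains X"
  shows "(\<lambda>n \<sigma>. - z n \<sigma>) \<in> singular_cochains X"
proof -
  have "finite {n. (\<lambda>\<sigma>. - z n \<sigma>) \<noteq> (\<lambda>\<sigma>. 0)}"
    using assms by (simp add: singular_cochains_def fun_eq_iff)
  then show ?thesis using assms by (simp add: singular_cochains_def)
qed

lemma cochain_differential_add:
  "cochain_differential X (\<lambda>n \<sigma>. z n \<sigma> + w n \<sigma>) =
     (\<lambda>n \<sigma>. cochain_differential X z n \<sigma> + cochain_differential X w n \<sigma>)"
  by (intro ext) (auto simp: cochain_differential_def distrib_left sum.distrib)

lemma cochain_differential_uminus: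
  "cochain_differential X (\<lambda>n \<sigma>. - z n \<sigma>) = (\<lambda>n \<sigma>. - cochain_differential X z n \<sigma>)"
  by (intro ext) (auto simp: cochain_differential_def sum_negf)

lemma cochain_differential_zero: "cochain_differential X (\<lambda>n \<sigma>. 0) = (\<lambda>n \<sigma>. 0)"
  by (intro ext) (auto simp: cochain_differential_def)

lemma zero_in_singular_cochains: "(\<lambda>n \<sigma>. 0) \<in> singular_cochains X"
  by (simp add: singular_cochains_def)

lemma coboundaries_0: "(\<lambda>n \<sigma>. 0) \<in> coboundaries X"
  unfolding coboundaries_def
  by (rule image_eqI[OF _ zero_in_singular_cochains]) (simp add: cochain_differential_zero)

lemma coboundaries_add:
  assumes "z \<in> coboundaries X" "w \<in> coboundaries X"
  shows "(\<lambda>n \<sigma>. z n \<sigma> + w n \<sigma>) \<in> coboundaries X"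
proof -
  obtain a b where "a \<in> singular_cochains X" "z = cochain_differential X a"
    "b \<in> singular_cochains X" "w = cochain_differential X b"
    using assms unfolding coboundaries_def by blast
  then show ?thesis
    unfolding coboundaries_def
    by (intro image_eqI[OF _ singular_cochains_add[of a X b]]) (simp_all add: cochain_differential_add)
qed

lemma coboundaries_uminus:
  assumes "z \<in> coboundaries X"
  shows "(\<lambda>n \<sigma>. - z n \<sigma>) \<in> coboundaries X"
proof -
  obtain a where "a \<in> singular_cochains X" "z = cochain_differential X a"
    using assms unfolding coboundaries_def by blast
  then show ?thesis
    unfolding coboundaries_def
    by (intro image_eqI[OF _ singular_cochains_uminus[of a X]]) (simp_all add: cochain_differential_uminus)
qed

lemma singular_cocycles_add:
  "z \<in> singular_cocycles X \<Longrightarrow> w \<in> singular_cocycles X \<Longrightarrow> (\<lambda>n \<sigma>. z n \<sigma> + w n \<sigma>) \<in> singular_cocycles X"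
  by (simp add: singular_cocycles_def singular_cochains_add cochain_differential_add)

lemma cochain_differential_in_cocycles:
  assumes e: "e \<in> singular_cochains X"
  shows "cochain_differential X e \<in> singular_cocycles X"
proof -
  have "{n. cochain_differential X e n \<noteq> (\<lambda>\<sigma>. 0)} \<subseteq> Suc ` {n. e n \<noteq> (\<lambda>\<sigma>. 0)}"
  proof
    fix n assume "n \<in> {n. cochain_differential X e n \<noteq> (\<lambda>\<sigma>. 0)}"
    then obtain \<sigma> where \<sigma>: "cochain_differential X e n \<sigma> \<noteq> 0" by (auto simp: fun_eq_iff)
    then obtain m where m: "n = Suc m" by (cases n) auto
    have "e m \<noteq> (\<lambda>\<sigma>. 0)"
      using \<sigma> by (force simp: m cochain_differential_def simp del: sum.atMost_Suc split: if_splits)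
    then show "n \<in> Suc ` {n. e n \<noteq> (\<lambda>\<sigma>. 0)}" using m by blast
  qed
  then have "finite {n. cochain_differential X e n \<noteq> (\<lambda>\<sigma>. 0)}"
    by (rule finite_subset) (use e in \<open>simp add: singular_cochains_def\<close>)
  moreover have "cochain_differential X (cochain_differential X e) n \<sigma> = 0" for n \<sigma>
  proof (cases "singular_simplex n X \<sigma> \<and> n \<noteq> 0")
    case True
    then obtain m where m: "n = Suc m" "singular_simplex (Suc m) X \<sigma>" by (cases n) auto
    then have c: "singular_chain (Suc m) X (frag_of \<sigma>)" by (simp add: singular_chain_of)
    show ?thesis
    proof (cases m)
      case 0
      then show ?thesis
        using m by (simp add: cochain_differential_Suc cochain_eval_eq_0)
    next
      case (Suc l)
      then show ?thesis
        using m(2) chain_boundary_boundary_alt[of "Suc l" X "frag_of \<sigma>"] c singular_chain_boundary_alt[OF c]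
        by (simp add: m(1) cochain_differential_Suc cochain_eval_differential)
    qed
  qed (auto simp: cochain_differential_def)
  ultimately show ?thesis
    by (auto simp: singular_cocycles_def singular_cochains_def cochain_differential_def)
qed

lemma coboundaries_subset_cocycles: "coboundaries X \<subseteq> singular_cocycles X"
  using cochain_differential_in_cocycles by (auto simp: coboundaries_def)

section \<open>The Leibniz rule for the cup product\<close>

text \<open>Shifting by \<open>m\<close> places is the \<open>m\<close>-fold iterate of the face map omitting vertex \<open>0\<close>.\<close>

lemma shift_in_standard_simplex:
  assumes "y \<in> standard_simplex n"
  shows "(\<lambda>i. if i < m then 0 else y (i - m)) \<in> standard_simplex (m + n)"
proof (induction m)
  case 0
  then show ?case using assms by simp
next
  case (Suc m)
  have "(\<lambda>i. if i < Suc m then 0 else y (i - Suc m)) =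
      simplical_face 0 (\<lambda>i. if i < m then 0 else y (i - m))"
    by (auto simp: simplical_face_def fun_eq_iff)
  then show ?case
    using simplical_face_in_standard_simplex[of "Suc m + n" 0] Suc by simp
qed

lemma singular_simplex_front_face:
  assumes "singular_simplex n X \<sigma>" "m \<le> n"
  shows "singular_simplex m X (front_face m \<sigma>)"
proof -
  have "continuous_map (subtopology (powertop_real UNIV) (standard_simplex m)) X \<sigma>"
    using assms standard_simplex_mono[of m n]
    by (auto simp: singular_simplex_def intro: continuous_map_from_subtopology_mono)
  then have "continuous_map (subtopology (powertop_real UNIV) (standard_simplex m)) X (front_face m \<sigma>)"
    by (rule continuous_map_eq) (simp add: front_face_def)
  then show ?thesis by (simp add: singular_simplex_def front_face_def)
qed

lemma back_face_Suc: "back_face (Suc m) n \<sigma> = singular_face (Suc n) 0 (back_face m (Suc n) \<sigma>)"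
proof -
  have "(\<lambda>i. if i < Suc m then 0 else x (i - Suc m)) =
      (\<lambda>i. if i < m then 0 else simplical_face 0 x (i - m))" for x :: "nat \<Rightarrow> real"
    by (auto simp: simplical_face_def fun_eq_iff)
  then show ?thesis
    using simplical_face_in_standard_simplex[of "Suc n" 0]
    by (intro ext) (auto simp: back_face_def singular_face_def)
qed

lemma singular_simplex_back_face:
  "singular_simplex (m + n) X \<sigma> \<Longrightarrow> singular_simplex n X (back_face m n \<sigma>)"
proof (induction m arbitrary: n)
  case 0
  then show ?case
    by (simp add: back_face_def singular_simplex_def extensional_restrict)
next
  case (Suc m)
  then have "singular_simplex (Suc n) X (back_face m (Suc n) \<sigma>)" by simp
  then show ?case
    using singular_simplex_singular_face[of "Suc n" X _ 0] by (simp add: back_face_Suc)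
qed

lemma front_face_singular_face_le:
  assumes "k \<le> m" "m \<le> n"
  shows "front_face m (singular_face (Suc n) k \<sigma>) = singular_face (Suc m) k (front_face (Suc m) \<sigma>)"
  using simplical_face_in_standard_simplex[of "Suc m" k] assms standard_simplex_mono[of m n]
  by (intro ext) (auto simp: front_face_def singular_face_def)

text \<open>Omitting a vertex behind the front part does not change the front part.\<close>

lemma front_face_singular_face_gt:
  assumes "m < k" "m \<le> n"
  shows "front_face m (singular_face (Suc n) k \<sigma>) = front_face m \<sigma>"
proof -
  have "simplical_face k x = x" if "x \<in> standard_simplex m" for x :: "nat \<Rightarrow> real"
    using that assms by (auto simp: simplical_face_def standard_simplex_def fun_eq_iff)
  then show ?thesis
    using assms standard_simplex_mono[of m n]
    by (intro ext) (auto simp: front_face_def singular_face_def)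
qed

lemma front_face_last: "singular_face (Suc m) (Suc m) (front_face (Suc m) \<sigma>) = front_face m \<sigma>"
proof -
  have "simplical_face (Suc m) x = x" if "x \<in> standard_simplex m" for x :: "nat \<Rightarrow> real"
    using that by (auto simp: simplical_face_def standard_simplex_def fun_eq_iff)
  then show ?thesis
    using standard_simplex_mono[of m "Suc m"]
    by (intro ext) (auto simp: front_face_def singular_face_def)
qed

lemma back_face_singular_face_le:
  assumes "k \<le> m"
  shows "back_face m l (singular_face (Suc (m + l)) k \<sigma>) = back_face (Suc m) l \<sigma>"
proof -
  have "simplical_face k (\<lambda>i. if i < m then 0 else x (i - m)) =
      (\<lambda>i. if i < Suc m then 0 else x (i - Suc m))" for x :: "nat \<Rightarrow> real"
    using assms by (auto simp: simplical_face_def fun_eq_iff)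
  then show ?thesis
    using shift_in_standard_simplex[of _ l m]
    by (intro ext) (auto simp: back_face_def singular_face_def)
qed

lemma back_face_singular_face_gt:
  assumes "0 < j" "j \<le> Suc l"
  shows "back_face m l (singular_face (Suc (m + l)) (m + j) \<sigma>) = singular_face (Suc l) j (back_face m (Suc l) \<sigma>)"
proof -
  have "simplical_face (m + j) (\<lambda>i. if i < m then 0 else x (i - m)) =
      (\<lambda>i. if i < m then 0 else simplical_face j x (i - m))" for x :: "nat \<Rightarrow> real"
  proof
    fix i
    have "i - Suc 0 - m = i - m - Suc 0" "i < m + j \<longleftrightarrow> i - m < j" "i = m + j \<longleftrightarrow> i - m = j"
      using assms by auto
    then show "simplical_face (m + j) (\<lambda>i. if i < m then 0 else x (i - m)) i =
      (if i < m then 0 else simplical_face j x (i - m))"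
      by (auto simp: simplical_face_def)
  qed
  then show ?thesis
    using shift_in_standard_simplex[of _ l m] simplical_face_in_standard_simplex[of "Suc l" j] assms
    by (intro ext) (auto simp: back_face_def singular_face_def)
qed

text \<open>The sign in the Leibniz rule depends on the degree of the first factor. For inhomogeneous cochains
  it is an operator, acting by \<open>(-1)\<^sup>n\<close> in degree \<open>n\<close>.\<close>

definition sign_twist :: "('a, 'r::comm_ring_1) cochain \<Rightarrow> ('a, 'r) cochain" where
  "sign_twist a = (\<lambda>n \<sigma>. (-1) ^ n * a n \<sigma>)"

lemma sign_twist_twist: "sign_twist (sign_twist a) = a"
  by (simp add: sign_twist_def fun_eq_iff mult.assoc[symmetric] flip: power_add)

lemma cochain_differential_sign_twist:
  "cochain_differential X (sign_twist a) = (\<lambda>n \<sigma>. - sign_twist (cochain_differential X a) n \<sigma>)"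
proof (intro ext)
  fix n \<sigma>
  show "cochain_differential X (sign_twist a) n \<sigma> = - sign_twist (cochain_differential X a) n \<sigma>"
    by (cases n) (auto simp: cochain_differential_def sign_twist_def sum_distrib_left sum_negf[symmetric]
        algebra_simps simp del: sum.atMost_Suc intro!: sum.cong)
qed

text \<open>The contribution of one splitting of the vertices into a front and a back part. The faces
  omitting a vertex of the front part and those omitting one of the back part give the two
  terms, except that each of the terms also contains the face at which the two parts meet; there
  the signs are opposite.\<close>

lemma cup_boundary_term:
  fixes a b :: "('a, 'r::comm_ring_1) cochain"
  assumes \<sigma>: "singular_simplex (Suc (m + l)) X \<sigma>"
  shows "(\<Sum>k\<le>Suc (m + l). (-1) ^ k *
            (a m (front_face m (singular_face (Suc (m + l)) k \<sigma>)) *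
             b l (back_face m l (singular_face (Suc (m + l)) k \<sigma>)))) =
         cochain_differential X a (Suc m) (front_face (Suc m) \<sigma>) * b l (back_face (Suc m) l \<sigma>) +
         sign_twist a m (front_face m \<sigma>) * cochain_differential X b (Suc l) (back_face m (Suc l) \<sigma>)"
proof -
  let ?F = "front_face (Suc m) \<sigma>" and ?B = "back_face m (Suc l) \<sigma>"
  define g where "g = (\<lambda>k. (-1) ^ k *
            (a m (front_face m (singular_face (Suc (m + l)) k \<sigma>)) *
             b l (back_face m l (singular_face (Suc (m + l)) k \<sigma>))))"
  have F: "singular_simplex (Suc m) X ?F"
    using \<sigma> by (rule singular_simplex_front_face) simp
  have B: "singular_simplex (Suc l) X ?B"
    using \<sigma> by (intro singular_simplex_back_face) simp
  have "{..Suc (m + l)} = {..m} \<union> {Suc m..Suc (m + l)}" by auto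
  then have "sum g {..Suc (m + l)} = sum g {..m} + sum g {Suc m..Suc (m + l)}"
    by (simp add: sum.union_disjoint[symmetric] del: sum.atMost_Suc sum.cl_ivl_Suc)
  also have "sum g {..m} = (\<Sum>k\<le>m. (-1) ^ k * a m (singular_face (Suc m) k ?F)) * b l (back_face (Suc m) l \<sigma>)"
    unfolding sum_distrib_right g_def
    by (intro sum.cong) (simp_all add: front_face_singular_face_le back_face_singular_face_le mult.assoc)
  also have "sum g {Suc m..Suc (m + l)} = (\<Sum>j=1..Suc l. g (m + j))"
    by (rule sum.reindex_bij_witness[of _ "\<lambda>j. m + j" "\<lambda>k. k - m"]) auto
  also have "\<dots> = sign_twist a m (front_face m \<sigma>) *
      (\<Sum>j=1..Suc l. (-1) ^ j * b l (singular_face (Suc l) j ?B))"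
    unfolding sum_distrib_left g_def sign_twist_def
    by (intro sum.cong) (simp_all add: front_face_singular_face_gt back_face_singular_face_gt power_add mult_ac)
  also have "(\<Sum>k\<le>m. (-1) ^ k * a m (singular_face (Suc m) k ?F)) =
      cochain_differential X a (Suc m) ?F + sign_twist a m (front_face m \<sigma>)"
    using F by (simp add: cochain_differential_def front_face_last sign_twist_def)
  also have "(\<Sum>j=1..Suc l. (-1) ^ j * b l (singular_face (Suc l) j ?B)) =
      cochain_differential X b (Suc l) ?B - b l (back_face (Suc m) l \<sigma>)"
    using B by (simp add: cochain_differential_def back_face_Suc atMost_atLeast0
        sum.atLeast_Suc_atMost[of 0] del: sum.atMost_Suc sum.cl_ivl_Suc)
  finally show ?thesis
    unfolding g_def by (simp add: algebra_simps)
qed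

lemma cochain_differential_cup:
  fixes a b :: "('a, 'r::comm_ring_1) cochain"
  shows "cochain_differential X (cup_cochain X a b) =
     (\<lambda>n \<sigma>. cup_cochain X (cochain_differential X a) b n \<sigma> +
             cup_cochain X (sign_twist a) (cochain_differential X b) n \<sigma>)"
proof (intro ext)
  fix n \<sigma>
  show "cochain_differential X (cup_cochain X a b) n \<sigma> =
     cup_cochain X (cochain_differential X a) b n \<sigma> +
             cup_cochain X (sign_twist a) (cochain_differential X b) n \<sigma>"
  proof (cases n)
    case 0
    then show ?thesis by (simp add: cup_cochain_def cochain_differential_def)
  next
    case (Suc N)
    show ?thesis
    proof (cases "singular_simplex n X \<sigma>")
      case False
      then show ?thesis by (simp add: cup_cochain_def cochain_differential_def)
    next
      case True
      let ?t = "\<lambda>k m. a m (front_face m (singular_face (Suc N) k \<sigma>)) *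
           b (N - m) (back_face m (N - m) (singular_face (Suc N) k \<sigma>))"
      have "cochain_differential X (cup_cochain X a b) n \<sigma> =
          (\<Sum>k\<le>Suc N. \<Sum>m\<le>N. (-1) ^ k * ?t k m)"
        using True singular_simplex_singular_face[OF True]
        by (auto simp: Suc cochain_differential_def cup_cochain_def sum_distrib_left
            simp del: sum.atMost_Suc intro!: sum.cong)
      also have "\<dots> = (\<Sum>m\<le>N. \<Sum>k\<le>Suc N. (-1) ^ k * ?t k m)"
        by (rule sum.swap)
      also have "\<dots> = (\<Sum>m\<le>N.
          cochain_differential X a (Suc m) (front_face (Suc m) \<sigma>) * b (N - m) (back_face (Suc m) (N - m) \<sigma>) +
          sign_twist a m (front_face m \<sigma>) *
            cochain_differential X b (Suc (N - m)) (back_face m (Suc (N - m)) \<sigma>))"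
      proof (intro sum.cong refl)
        fix m assume "m \<in> {..N}"
        then show "(\<Sum>k\<le>Suc N. (-1) ^ k * ?t k m) =
          cochain_differential X a (Suc m) (front_face (Suc m) \<sigma>) * b (N - m) (back_face (Suc m) (N - m) \<sigma>) +
          sign_twist a m (front_face m \<sigma>) *
            cochain_differential X b (Suc (N - m)) (back_face m (Suc (N - m)) \<sigma>)"
          using cup_boundary_term[of m "N - m" X \<sigma> a b] True Suc by (simp del: sum.atMost_Suc)
      qed
      also have "\<dots> = cup_cochain X (cochain_differential X a) b n \<sigma> +
             cup_cochain X (sign_twist a) (cochain_differential X b) n \<sigma>"
      proof -
        have "cup_cochain X (cochain_differential X a) b n \<sigma> = (\<Sum>m\<le>N.
          cochain_differential X a (Suc m) (front_face (Suc m) \<sigma>) * b (N - m) (back_face (Suc m) (N - m) \<sigma>))"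
          using True by (simp add: cup_cochain_def Suc sum.atMost_Suc_shift del: sum.atMost_Suc)
        moreover have "cup_cochain X (sign_twist a) (cochain_differential X b) n \<sigma> = (\<Sum>m\<le>N.
          sign_twist a m (front_face m \<sigma>) *
            cochain_differential X b (Suc (N - m)) (back_face m (Suc (N - m)) \<sigma>))"
          using True by (simp add: cup_cochain_def Suc Suc_diff_le)
        ultimately show ?thesis by (simp add: sum.distrib)
      qed
      finally show ?thesis .
    qed
  qed
qed

lemma cup_cochain_add_left:
  "cup_cochain X (\<lambda>n \<sigma>. a n \<sigma> + a' n \<sigma>) b = (\<lambda>n \<sigma>. cup_cochain X a b n \<sigma> + cup_cochain X a' b n \<sigma>)"
  by (intro ext) (simp add: cup_cochain_def distrib_right sum.distrib)

lemma cup_cochain_add_right: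
  "cup_cochain X a (\<lambda>n \<sigma>. b n \<sigma> + b' n \<sigma>) = (\<lambda>n \<sigma>. cup_cochain X a b n \<sigma> + cup_cochain X a b' n \<sigma>)"
  by (intro ext) (simp add: cup_cochain_def distrib_left sum.distrib)

lemma cup_cochain_zero_left [simp]: "cup_cochain X (\<lambda>n \<sigma>. 0) b = (\<lambda>n \<sigma>. 0)"
  by (intro ext) (simp add: cup_cochain_def)

lemma cup_cochain_zero_right [simp]: "cup_cochain X a (\<lambda>n \<sigma>. 0) = (\<lambda>n \<sigma>. 0)"
  by (intro ext) (simp add: cup_cochain_def)

lemma cup_cochain_in_singular_cochains:
  assumes "a \<in> singular_cochains X" "b \<in> singular_cochains X"
  shows "cup_cochain X a b \<in> singular_cochains X"
proof -
  let ?A = "{n. a n \<noteq> (\<lambda>\<sigma>. 0)}" and ?B = "{n. b n \<noteq> (\<lambda>\<sigma>. 0)}"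
  have "{n. cup_cochain X a b n \<noteq> (\<lambda>\<sigma>. 0)} \<subseteq> (\<lambda>(i, j). i + j) ` (?A \<times> ?B)"
  proof
    fix n assume "n \<in> {n. cup_cochain X a b n \<noteq> (\<lambda>\<sigma>. 0)}"
    then obtain \<sigma> where "cup_cochain X a b n \<sigma> \<noteq> 0" by (auto simp: fun_eq_iff)
    then obtain m where "m \<le> n" "a m (front_face m \<sigma>) * b (n - m) (back_face m (n - m) \<sigma>) \<noteq> 0"
      by (force simp: cup_cochain_def split: if_splits elim: sum.not_neutral_contains_not_neutral)
    then have "a m \<noteq> (\<lambda>\<sigma>. 0)" "b (n - m) \<noteq> (\<lambda>\<sigma>. 0)" "n = m + (n - m)" by auto
    then show "n \<in> (\<lambda>(i, j). i + j) ` (?A \<times> ?B)" by force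
  qed
  then have "finite {n. cup_cochain X a b n \<noteq> (\<lambda>\<sigma>. 0)}"
    by (rule finite_subset) (use assms in \<open>simp add: singular_cochains_def\<close>)
  then show ?thesis by (auto simp: singular_cochains_def cup_cochain_def)
qed

lemma sign_twist_in_singular_cochains:
  assumes "a \<in> singular_cochains X"
  shows "sign_twist a \<in> singular_cochains X"
proof -
  have "finite {n. sign_twist a n \<noteq> (\<lambda>\<sigma>. 0)}"
    by (rule rev_finite_subset[of "{n. a n \<noteq> (\<lambda>\<sigma>. 0)}"])
      (use assms in \<open>auto simp: singular_cochains_def sign_twist_def\<close>)
  then show ?thesis using assms by (simp add: singular_cochains_def sign_twist_def)
qed

lemma cup_cocycles:
  assumes "a \<in> singular_cocycles X" "b \<in> singular_cocycles X"
  shows "cup_cochain X a b \<in> singular_cocycles X"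
  using assms by (simp add: singular_cocycles_def cup_cochain_in_singular_cochains cochain_differential_cup)

lemma cup_coboundary_left:
  assumes "a \<in> coboundaries X" "b \<in> singular_cocycles X"
  shows "cup_cochain X a b \<in> coboundaries X"
proof -
  obtain e where e: "e \<in> singular_cochains X" "a = cochain_differential X e"
    using assms(1) by (auto simp: coboundaries_def)
  then have "cup_cochain X a b = cochain_differential X (cup_cochain X e b)"
    using singular_cocyclesD(2)[OF assms(2)] by (simp add: cochain_differential_cup)
  then show ?thesis
    using cup_cochain_in_singular_cochains[OF e(1) singular_cocyclesD(1)[OF assms(2)]]
    by (auto simp: coboundaries_def)
qed

text \<open>As \<open>a\<close> is a cocycle, so is its sign twist, and the Leibniz rule for the twist times a primitive
  \<open>e\<close> of \<open>b\<close> has only the term with \<open>a\<close> and \<open>b\<close> left.\<close>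

lemma cup_coboundary_right:
  assumes "a \<in> singular_cocycles X" "b \<in> coboundaries X"
  shows "cup_cochain X a b \<in> coboundaries X"
proof -
  obtain e where e: "e \<in> singular_cochains X" "b = cochain_differential X e"
    using assms(2) by (auto simp: coboundaries_def)
  have "cochain_differential X (sign_twist a) = (\<lambda>n \<sigma>. 0)"
    using singular_cocyclesD(2)[OF assms(1)]
    by (simp add: cochain_differential_sign_twist) (simp add: sign_twist_def)
  then have "cup_cochain X a b = cochain_differential X (cup_cochain X (sign_twist a) e)"
    by (simp add: cochain_differential_cup e(2) sign_twist_twist)
  then show ?thesis
    using cup_cochain_in_singular_cochains[OF
        sign_twist_in_singular_cochains[OF singular_cocyclesD(1)[OF assms(1)]] e(1)]
    by (auto simp: coboundaries_def)
qed

section \<open>Products of cohomology classes\<close>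

definition cohomology_class :: "'a topology \<Rightarrow> ('a, 'r::comm_ring_1) cochain \<Rightarrow> ('a, 'r) cochain set" where
  "cohomology_class X z = coboundaries X +>\<^bsub>cocycle_ring X\<^esub> z"

lemma in_cohomology_class_iff:
  "w \<in> cohomology_class X z \<longleftrightarrow> (\<exists>x \<in> coboundaries X. w = (\<lambda>n \<sigma>. x n \<sigma> + z n \<sigma>))"
  by (simp add: cohomology_class_def a_r_coset_def' cocycle_ring_def)

lemma cohomology_class_self: "z \<in> cohomology_class X z"
  unfolding in_cohomology_class_iff by (rule bexI[OF _ coboundaries_0]) simp

lemma cohomology_class_cong:
  assumes "w \<in> cohomology_class X z"
  shows "cohomology_class X w = cohomology_class X z"
proof -
  obtain x where x: "x \<in> coboundaries X" "w = (\<lambda>n \<sigma>. x n \<sigma> + z n \<sigma>)"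
    using assms by (auto simp: in_cohomology_class_iff)
  have "v \<in> cohomology_class X w \<longleftrightarrow> v \<in> cohomology_class X z" for v
  proof
    assume "v \<in> cohomology_class X w"
    then obtain y where y: "y \<in> coboundaries X" "v = (\<lambda>n \<sigma>. y n \<sigma> + w n \<sigma>)"
      by (auto simp: in_cohomology_class_iff)
    then show "v \<in> cohomology_class X z"
      unfolding in_cohomology_class_iff
      by (intro bexI[OF _ coboundaries_add[OF y(1) x(1)]]) (simp add: x(2) add.assoc)
  next
    assume "v \<in> cohomology_class X z"
    then obtain y where y: "y \<in> coboundaries X" "v = (\<lambda>n \<sigma>. y n \<sigma> + z n \<sigma>)"
      by (auto simp: in_cohomology_class_iff)
    then show "v \<in> cohomology_class X w"
      unfolding in_cohomology_class_iff
      by (intro bexI[OF _ coboundaries_add[OF y(1) coboundaries_uminus[OF x(1)]]]) (simp add: x(2))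
  qed
  then show ?thesis by blast
qed

lemma cohomology_class_coboundary:
  fixes z :: "('a, 'r::comm_ring_1) cochain"
  assumes z: "z \<in> coboundaries X"
  shows "cohomology_class X z = coboundaries X"
proof -
  have "cohomology_class X (\<lambda>n \<sigma>. 0 :: 'r) = coboundaries X"
    by (auto simp: in_cohomology_class_iff)
  moreover from this have "cohomology_class X z = cohomology_class X (\<lambda>n \<sigma>. 0)"
    using z by (intro cohomology_class_cong) simp
  ultimately show ?thesis by simp
qed

lemma carrier_singular_cohomology:
  "carrier (singular_cohomology X) = cohomology_class X ` singular_cocycles X"
  by (auto simp: singular_cohomology_def FactRing_def A_RCOSETS_defs cohomology_class_def
      a_r_coset_def r_coset_def carrier_cocycle_ring)

lemma zero_singular_cohomology: "\<zero>\<^bsub>singular_cohomology X\<^esub> = coboundaries X"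
  by (simp add: singular_cohomology_def FactRing_def)

text \<open>Coboundaries absorb products with cocycles on either side, so the union defining the product of
  two cosets consists of copies of a single coset.\<close>

lemma mult_singular_cohomology:
  assumes a: "a \<in> singular_cocycles X" and b: "b \<in> singular_cocycles X"
  shows "cohomology_class X a \<otimes>\<^bsub>singular_cohomology X\<^esub> cohomology_class X b =
     cohomology_class X (cup_cochain X a b)"
proof -
  have "cohomology_class X (cup_cochain X v w) = cohomology_class X (cup_cochain X a b)"
    if "v \<in> cohomology_class X a" "w \<in> cohomology_class X b" for v w
  proof (rule cohomology_class_cong)
    obtain x y where x: "x \<in> coboundaries X" "v = (\<lambda>n \<sigma>. x n \<sigma> + a n \<sigma>)"
      and y: "y \<in> coboundaries X" "w = (\<lambda>n \<sigma>. y n \<sigma> + b n \<sigma>)"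
      using \<open>v \<in> cohomology_class X a\<close> \<open>w \<in> cohomology_class X b\<close>
      unfolding in_cohomology_class_iff by auto
    have w: "w \<in> singular_cocycles X"
      using singular_cocycles_add[of y X b] y b coboundaries_subset_cocycles[of X] by auto
    show "cup_cochain X v w \<in> cohomology_class X (cup_cochain X a b)"
      unfolding in_cohomology_class_iff
      by (intro bexI[OF _ coboundaries_add[OF cup_coboundary_left[OF x(1) w] cup_coboundary_right[OF a y(1)]]])
        (simp add: x(2) cup_cochain_add_left, simp add: y(2) cup_cochain_add_right add.assoc)
  qed
  then have "cohomology_class X a \<otimes>\<^bsub>singular_cohomology X\<^esub> cohomology_class X b =
      (\<Union>v\<in>cohomology_class X a. \<Union>w\<in>cohomology_class X b. cohomology_class X (cup_cochain X a b))"
    by (simp add: singular_cohomology_def FactRing_def rcoset_mult_def cohomology_class_def cocycle_ring_def)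
  then show ?thesis
    using cohomology_class_self by blast
qed

section \<open>Cocycles vanishing on small simplices\<close>

lemma singular_chain_iterated_subdivision:
  "singular_chain n X c \<Longrightarrow> singular_chain n X ((singular_subdivision n ^^ i) c)"
  by (induction i) (simp_all add: singular_chain_singular_subdivision)

lemma chain_boundary_iterated_subdivision:
  assumes "singular_chain (Suc n) X c"
  shows "chain_boundary (Suc n) ((singular_subdivision (Suc n) ^^ i) c) =
     (singular_subdivision n ^^ i) (chain_boundary (Suc n) c)"
proof (induction i)
  case (Suc i)
  have "chain_boundary (Suc n) (singular_subdivision (Suc n) ((singular_subdivision (Suc n) ^^ i) c)) =
      singular_subdivision n (chain_boundary (Suc n) ((singular_subdivision (Suc n) ^^ i) c))"
    using chain_boundary_singular_subdivision[OF singular_chain_iterated_subdivision[OF assms]] by simp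
  then show ?case using Suc by simp
qed simp

text \<open>Subdividing a simplex \<open>\<sigma>\<close> again and again ends in small simplices, and the natural chain
  homotopy \<open>h\<close> from the identity to the subdivision operator \<open>S\<close> maps small chains to small
  chains. So \<open>z (h (S\<^sup>i \<sigma>))\<close> vanishes for large \<open>i\<close>, and minus the sum over all \<open>i\<close> is a
  well-defined cochain; its coboundary telescopes to \<open>z\<close>, as \<open>z\<close> vanishes on boundaries.\<close>

lemma cocycle_vanishing_on_small_simplices:
  fixes z :: "('a, 'r::comm_ring_1) cochain"
  assumes z: "z \<in> singular_cocycles X"
    and opn: "\<And>V. V \<in> \<C> \<Longrightarrow> openin X V" and cover: "topspace X \<subseteq> \<Union>\<C>"
    and small: "\<And>n \<sigma> V. V \<in> \<C> \<Longrightarrow> singular_simplex n (subtopology X V) \<sigma> \<Longrightarrow> z n \<sigma> = 0"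
  shows "z \<in> coboundaries X"
proof -
  obtain h where h:
        "\<And>p. h p (0::'a chain) = 0"
        "\<And>p c1 c2. h p (c1-c2) = h p c1 - h p c2"
        "\<And>p X c. singular_chain p X c \<Longrightarrow> singular_chain (Suc p) X (h p c)"
        "\<And>p X c. singular_chain p X c
                 \<Longrightarrow> chain_boundary (Suc p) (h p c) + h (p - Suc 0) (chain_boundary p c) = singular_subdivision p c - c"
    by (rule chain_homotopic_singular_subdivision) (rule that)
  let ?S = "\<lambda>n i. singular_subdivision n ^^ i"
  define t where "t = (\<lambda>n i c. cochain_eval (z (Suc n)) (h n (?S n i c)))"
  have t_0: "t n i 0 = 0" for n i
    by (simp add: t_def h)
  have t_diff: "t n i (c - d) = t n i c - t n i d" for n i c d
    by (simp add: t_def singular_subdivision_power_diff h cochain_eval_diff)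
  have small_eval: "cochain_eval (z n) c = 0"
    if c: "\<And>\<sigma>. \<sigma> \<in> Poly_Mapping.keys c \<Longrightarrow> \<exists>V\<in>\<C>. singular_simplex n (subtopology X V) \<sigma>" for n c
    using c small by (blast intro: cochain_eval_eq_0)
  \<comment> \<open>Naturality in the form that \<open>h\<close> keeps chains inside each open set of the cover.\<close>
  have small_h: "cochain_eval (z (Suc n)) (h n c) = 0"
    if c: "Poly_Mapping.keys c \<subseteq> {\<sigma>. \<exists>V\<in>\<C>. singular_simplex n (subtopology X V) \<sigma>}" for n c
    using c
  proof (induction c rule: frag_induction)
    case (one \<sigma>)
    then obtain V where V: "V \<in> \<C>" "singular_chain n (subtopology X V) (frag_of \<sigma>)"
      by (auto simp: singular_chain_of)
    have "singular_chain (Suc n) (subtopology X V) (h n (frag_of \<sigma>))"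
      by (rule h(3)[OF V(2)])
    then show ?case
      using V(1) by (intro small_eval) (auto simp: singular_chain_def)
  qed (auto simp: h cochain_eval_diff)
  have subdivided: "\<exists>N. \<forall>i\<ge>N. Poly_Mapping.keys (?S n i c) \<subseteq> {\<sigma>. \<exists>V\<in>\<C>. singular_simplex n (subtopology X V) \<sigma>}"
    if c: "singular_chain n X c" for n c
  proof -
    obtain N where N: "\<And>m f. \<lbrakk>N \<le> m; f \<in> Poly_Mapping.keys (?S n m c)\<rbrakk>
                      \<Longrightarrow> \<exists>V \<in> \<C>. f \<in> standard_simplex n \<rightarrow> V"
      using sufficient_iterated_singular_subdivision_exists[OF opn cover c] by blast
    have "\<exists>V\<in>\<C>. singular_simplex n (subtopology X V) f"
      if "N \<le> m" "f \<in> Poly_Mapping.keys (?S n m c)" for m f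
    proof -
      have "singular_simplex n X f"
        using singular_chain_iterated_subdivision[OF c, of m] that(2) by (auto simp: singular_chain_def)
      then show ?thesis
        using N[OF that] by (simp add: singular_simplex_subtopology image_subset_iff_funcset)
    qed
    then show ?thesis by blast
  qed
  define b where "b = (\<lambda>n \<sigma>. - (\<Sum>i | t n i (frag_of \<sigma>) \<noteq> 0. t n i (frag_of \<sigma>)))"
  have b_sum: "\<exists>N. \<forall>M\<ge>N. cochain_eval (b n) c = - (\<Sum>i<M. t n i c)"
    if c: "Poly_Mapping.keys c \<subseteq> {\<sigma>. singular_simplex n X \<sigma>}" for n c
    using c
  proof (induction c rule: frag_induction)
    case zero
    then show ?case by (simp add: t_0)
  next
    case (one \<sigma>)
    then have "singular_chain n X (frag_of \<sigma>)" by (simp add: singular_chain_of)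
    then obtain N where "\<forall>i\<ge>N. Poly_Mapping.keys (?S n i (frag_of \<sigma>)) \<subseteq>
        {\<sigma>. \<exists>V\<in>\<C>. singular_simplex n (subtopology X V) \<sigma>}"
      using subdivided by blast
    then have N: "\<forall>i\<ge>N. t n i (frag_of \<sigma>) = 0"
      unfolding t_def by (intro allI impI small_h) simp
    have "(\<Sum>i | t n i (frag_of \<sigma>) \<noteq> 0. t n i (frag_of \<sigma>)) = (\<Sum>i<M. t n i (frag_of \<sigma>))" if "N \<le> M" for M
    proof (rule sum.mono_neutral_left)
      show "{i. t n i (frag_of \<sigma>) \<noteq> 0} \<subseteq> {..<M}"
      proof
        fix i assume "i \<in> {i. t n i (frag_of \<sigma>) \<noteq> 0}"
        then have "\<not> N \<le> i" using N by auto
        then show "i \<in> {..<M}" using that by simp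
      qed
    qed auto
    then show ?case by (auto simp: b_def)
  next
    case (diff c d)
    then obtain N N' where N: "\<forall>M\<ge>N. cochain_eval (b n) c = - (\<Sum>i<M. t n i c)"
      "\<forall>M\<ge>N'. cochain_eval (b n) d = - (\<Sum>i<M. t n i d)" by blast
    have "cochain_eval (b n) (c - d) = - (\<Sum>i<M. t n i (c - d))" if "max N N' \<le> M" for M
    proof -
      have "cochain_eval (b n) c = - (\<Sum>i<M. t n i c)" "cochain_eval (b n) d = - (\<Sum>i<M. t n i d)"
        using N that by auto
      then show ?thesis by (simp only: cochain_eval_diff t_diff sum_subtractf minus_diff_minus minus_diff_eq)
    qed
    then show ?case by blast
  qed
  show ?thesis
  proof (rule coboundaryI)
    show "z \<in> singular_cochains X" using singular_cocyclesD(1)[OF z] .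
    show "z 0 \<sigma> = 0" if \<sigma>: "singular_simplex 0 X \<sigma>" for \<sigma>
    proof -
      obtain v :: "nat \<Rightarrow> real" where v: "standard_simplex 0 = {v}"
        by (simp add: standard_simplex_0)
      then have "\<sigma> v \<in> topspace X"
        using \<sigma> by (auto simp: singular_simplex_def continuous_map_def)
      then obtain V where "V \<in> \<C>" "\<sigma> v \<in> V" using cover by blast
      then show ?thesis
        using small[of V 0 \<sigma>] \<sigma> v by (simp add: singular_simplex_subtopology)
    qed
    show "cochain_eval (b n) (chain_boundary (Suc n) (frag_of \<sigma>)) = z (Suc n) \<sigma>"
      if \<sigma>: "singular_simplex (Suc n) X \<sigma>" for n \<sigma>
    proof -
      have c: "singular_chain (Suc n) X (frag_of \<sigma>)"
        using \<sigma> by (simp add: singular_chain_of)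
      define f where "f = (\<lambda>i. cochain_eval (z (Suc n)) (?S (Suc n) i (frag_of \<sigma>)))"
      have t_boundary: "t n i (chain_boundary (Suc n) (frag_of \<sigma>)) = f (Suc i) - f i" for i
      proof -
        let ?c = "?S (Suc n) i (frag_of \<sigma>)"
        have ci: "singular_chain (Suc n) X ?c"
          by (rule singular_chain_iterated_subdivision[OF c])
        have "h n (chain_boundary (Suc n) ?c) =
            singular_subdivision (Suc n) ?c - ?c - chain_boundary (Suc (Suc n)) (h (Suc n) ?c)"
          using h(4)[OF ci] by (simp add: algebra_simps)
        then show ?thesis
          using cocycle_eval_boundary[OF z h(3)[OF ci]]
          by (simp add: t_def f_def cochain_eval_diff flip: chain_boundary_iterated_subdivision[OF c])
      qed
      obtain N where N: "\<forall>M\<ge>N. cochain_eval (b n) (chain_boundary (Suc n) (frag_of \<sigma>)) =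
          - (\<Sum>i<M. t n i (chain_boundary (Suc n) (frag_of \<sigma>)))"
        using b_sum[of "chain_boundary (Suc n) (frag_of \<sigma>)" n] singular_chain_boundary_alt[OF c]
        by (auto simp: singular_chain_def)
      obtain N' where "\<forall>i\<ge>N'. Poly_Mapping.keys (?S (Suc n) i (frag_of \<sigma>)) \<subseteq>
          {\<sigma>. \<exists>V\<in>\<C>. singular_simplex (Suc n) (subtopology X V) \<sigma>}"
        using subdivided[OF c] by blast
      then have N': "\<forall>i\<ge>N'. f i = 0"
        unfolding f_def by (intro allI impI small_eval) blast
      have "cochain_eval (b n) (chain_boundary (Suc n) (frag_of \<sigma>)) =
          - (\<Sum>i<max N N'. t n i (chain_boundary (Suc n) (frag_of \<sigma>)))"
        using N by simp
      also have "\<dots> = f 0 - f (max N N')"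
        by (simp add: t_boundary sum_lessThan_telescope)
      also have "\<dots> = z (Suc n) \<sigma>"
        using N' by (simp add: f_def)
      finally show ?thesis .
    qed
    have "{n. \<exists>\<sigma>. singular_simplex n X \<sigma> \<and> b n \<sigma> \<noteq> 0} \<subseteq> Suc -` {n. z n \<noteq> (\<lambda>\<sigma>. 0)}"
    proof clarsimp
      fix n \<sigma> assume b: "b n \<sigma> \<noteq> 0" and z0: "z (Suc n) = (\<lambda>\<sigma>. 0)"
      have "t n i (frag_of \<sigma>) = 0" for i by (simp add: t_def z0 cochain_eval_eq_0)
      then show False using b by (simp add: b_def)
    qed
    then show "finite {n. \<exists>\<sigma>. singular_simplex n X \<sigma> \<and> b n \<sigma> \<noteq> 0}"
      by (rule finite_subset)
        (use singular_cocyclesD(1)[OF z] in \<open>intro finite_vimageI; simp add: singular_cochains_def\<close>)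
  qed
qed

section \<open>Products of locally trivial classes\<close>

definition vanishes_on :: "'a topology \<Rightarrow> ('a, 'r::comm_ring_1) cochain \<Rightarrow> bool" where
  "vanishes_on W c \<longleftrightarrow> (\<forall>n \<sigma>. singular_simplex n W \<sigma> \<longrightarrow> c n \<sigma> = 0)"

text \<open>Extension by zero makes a primitive on \<open>W\<close> a cochain on all of \<open>X\<close>; subtracting its coboundary
  kills the cocycle on the simplices of \<open>W\<close> without changing its class.\<close>

lemma subspace_coboundary_extends:
  assumes c: "c \<in> singular_cocycles X"
    and res: "cochain_pullback (subtopology X W) (\<lambda>x. x) c \<in> coboundaries (subtopology X W)"
  obtains c' where "c' \<in> singular_cocycles X" "cohomology_class X c' = cohomology_class X c"
    "vanishes_on (subtopology X W) c'"
proof -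
  obtain e where e: "e \<in> singular_cochains (subtopology X W)"
    "cochain_pullback (subtopology X W) (\<lambda>x. x) c = cochain_differential (subtopology X W) e"
    using res unfolding coboundaries_def by blast
  have eX: "e \<in> singular_cochains X"
    using e(1) by (auto simp: singular_cochains_def singular_simplex_subtopology)
  define x where "x = (\<lambda>n \<sigma>. - cochain_differential X e n \<sigma>)"
  define c' where "c' = (\<lambda>n \<sigma>. x n \<sigma> + c n \<sigma>)"
  have x: "x \<in> coboundaries X"
    unfolding x_def by (intro coboundaries_uminus) (use eX in \<open>simp add: coboundaries_def\<close>)
  have "c' \<in> singular_cocycles X"
    unfolding c'_def using x coboundaries_subset_cocycles c by (blast intro: singular_cocycles_add)
  moreover have "cohomology_class X c' = cohomology_class X c"
    by (rule cohomology_class_cong) (use x in \<open>auto simp: in_cohomology_class_iff c'_def\<close>)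
  moreover have "vanishes_on (subtopology X W) c'"
    unfolding vanishes_on_def
  proof (intro allI impI)
    fix n \<sigma> assume \<sigma>: "singular_simplex n (subtopology X W) \<sigma>"
    have "cochain_differential (subtopology X W) e n \<sigma> = cochain_differential X e n \<sigma>"
      using \<sigma> by (simp add: cochain_differential_def singular_simplex_subtopology)
    moreover have "cochain_pullback (subtopology X W) (\<lambda>x. x) c n \<sigma> = c n \<sigma>"
      using \<sigma> by (simp add: cochain_pullback_def simplex_map_id_gen)
    ultimately show "c' n \<sigma> = 0"
      using e(2) by (simp add: c'_def x_def)
  qed
  ultimately show ?thesis by (rule that)
qed

lemma one_cocycle: "(\<lambda>n \<sigma>. if n = 0 \<and> singular_simplex 0 X \<sigma> then 1 else 0) \<in> singular_cocycles X"
  (is "?one \<in> _")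
proof -
  have "finite {n. ?one n \<noteq> (\<lambda>\<sigma>. 0)}"
    by (rule finite_subset[of _ "{0}"]) (auto simp: fun_eq_iff split: if_splits)
  then have "?one \<in> singular_cochains X"
    by (simp add: singular_cochains_def)
  moreover have "cochain_differential X ?one = (\<lambda>n \<sigma>. 0)"
  proof (intro ext)
    fix n \<sigma>
    show "cochain_differential X ?one n \<sigma> = 0"
    proof (cases "n = 1 \<and> singular_simplex 1 X \<sigma>")
      case True
      then have "singular_simplex 0 X (singular_face 1 0 \<sigma>)" "singular_simplex 0 X (singular_face 1 1 \<sigma>)"
        using singular_simplex_singular_face[of 1 X \<sigma> 0] singular_simplex_singular_face[of 1 X \<sigma> 1] by auto
      then show ?thesis
        using True by (simp add: cochain_differential_def)
    next
      case False
      then show ?thesis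
        by (cases "n \<le> 1") (auto simp: cochain_differential_def le_Suc_eq intro!: sum.neutral)
    qed
  qed
  ultimately show ?thesis by (simp add: singular_cocycles_def)
qed

lemma one_singular_cohomology:
  "\<one>\<^bsub>singular_cohomology X\<^esub> =
     cohomology_class X (\<lambda>n \<sigma>. if n = 0 \<and> singular_simplex 0 X \<sigma> then 1 else 0)"
  by (simp add: singular_cohomology_def FactRing_def cohomology_class_def) (simp add: cocycle_ring_def)

lemma cup_vanishes_on:
  assumes "vanishes_on (subtopology X W) a \<or> vanishes_on (subtopology X W) b"
  shows "vanishes_on (subtopology X W) (cup_cochain X a b)"
  unfolding vanishes_on_def
proof (intro allI impI)
  fix n \<sigma> assume \<sigma>: "singular_simplex n (subtopology X W) \<sigma>"
  have "a m (front_face m \<sigma>) * b (n - m) (back_face m (n - m) \<sigma>) = 0" if "m \<le> n" for m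
  proof -
    have "singular_simplex m (subtopology X W) (front_face m \<sigma>)"
      using \<sigma> that by (rule singular_simplex_front_face)
    moreover have "singular_simplex (n - m) (subtopology X W) (back_face m (n - m) \<sigma>)"
      using \<sigma> that by (intro singular_simplex_back_face) simp
    ultimately show ?thesis
      using assms by (auto simp: vanishes_on_def)
  qed
  then show "cup_cochain X a b n \<sigma> = 0"
    by (simp add: cup_cochain_def)
qed

text \<open>A product vanishes on every subspace on which one factor does, because front and back faces stay
  in the subspace. One representative \<open>d\<close> of the product thus vanishes wherever any factor does.\<close>

lemma product_of_classes:
  assumes "\<forall>j\<in>set js. c j \<in> singular_cocycles X"
  shows "\<exists>d\<in>singular_cocycles X.
    foldr (\<otimes>\<^bsub>singular_cohomology X\<^esub>) (map (\<lambda>j. cohomology_class X (c j)) js) \<one>\<^bsub>singular_cohomology X\<^esub> = cohomology_class X d \<and>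
    (\<forall>W. (\<exists>j\<in>set js. vanishes_on (subtopology X W) (c j)) \<longrightarrow> vanishes_on (subtopology X W) d)"
  using assms
proof (induction js)
  case Nil
  show ?case
    by (rule bexI[OF _ one_cocycle]) (simp add: one_singular_cohomology)
next
  case (Cons i js)
  then obtain d where d: "d \<in> singular_cocycles X"
    "foldr (\<otimes>\<^bsub>singular_cohomology X\<^esub>) (map (\<lambda>j. cohomology_class X (c j)) js) \<one>\<^bsub>singular_cohomology X\<^esub> = cohomology_class X d"
    "\<forall>W. (\<exists>j\<in>set js. vanishes_on (subtopology X W) (c j)) \<longrightarrow> vanishes_on (subtopology X W) d"
    by auto
  have c: "c i \<in> singular_cocycles X" using Cons.prems by simp
  show ?case
  proof (intro bexI conjI allI impI)
    show "cup_cochain X (c i) d \<in> singular_cocycles X"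
      using c d(1) by (rule cup_cocycles)
    show "foldr (\<otimes>\<^bsub>singular_cohomology X\<^esub>) (map (\<lambda>j. cohomology_class X (c j)) (i # js)) \<one>\<^bsub>singular_cohomology X\<^esub> =
        cohomology_class X (cup_cochain X (c i) d)"
      using mult_singular_cohomology[OF c d(1)] d(2) by simp
    show "vanishes_on (subtopology X W) (cup_cochain X (c i) d)"
      if "\<exists>j\<in>set (i # js). vanishes_on (subtopology X W) (c j)" for W
      using that d(3) by (intro cup_vanishes_on) auto
  qed
qed

text \<open>The representatives that vanish on the respective \<open>W j\<close> multiply to a cocycle that vanishes on
  every simplex lying in one of these sets, and such a cocycle is a coboundary.\<close>

lemma cup_product_of_locally_trivial_classes:
  assumes cover: "topspace X \<subseteq> (\<Union>j\<in>set js. W j)" and opn: "\<And>j. j \<in> set js \<Longrightarrow> openin X (W j)"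
    and c: "\<And>j. j \<in> set js \<Longrightarrow> c j \<in> singular_cocycles X"
    and res: "\<And>j. j \<in> set js \<Longrightarrow>
       cochain_pullback (subtopology X (W j)) (\<lambda>x. x) (c j) \<in> coboundaries (subtopology X (W j))"
  shows "foldr (\<otimes>\<^bsub>singular_cohomology X\<^esub>) (map (\<lambda>j. cohomology_class X (c j)) js) \<one>\<^bsub>singular_cohomology X\<^esub>
     = \<zero>\<^bsub>singular_cohomology X\<^esub>"
proof -
  have "\<forall>j\<in>set js. \<exists>c'. c' \<in> singular_cocycles X \<and> cohomology_class X c' = cohomology_class X (c j) \<and>
      vanishes_on (subtopology X (W j)) c'"
  proof
    fix j assume j: "j \<in> set js"
    obtain c' where "c' \<in> singular_cocycles X" "cohomology_class X c' = cohomology_class X (c j)"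
      "vanishes_on (subtopology X (W j)) c'"
      by (rule subspace_coboundary_extends[OF c[OF j] res[OF j]])
    then show "\<exists>c'. c' \<in> singular_cocycles X \<and> cohomology_class X c' = cohomology_class X (c j) \<and>
      vanishes_on (subtopology X (W j)) c'" by blast
  qed
  from bchoice[OF this] obtain c' where c': "\<forall>j\<in>set js. c' j \<in> singular_cocycles X"
    "\<forall>j\<in>set js. cohomology_class X (c' j) = cohomology_class X (c j)"
    "\<forall>j\<in>set js. vanishes_on (subtopology X (W j)) (c' j)"
    by auto
  obtain d where d: "d \<in> singular_cocycles X"
    "foldr (\<otimes>\<^bsub>singular_cohomology X\<^esub>) (map (\<lambda>j. cohomology_class X (c' j)) js) \<one>\<^bsub>singular_cohomology X\<^esub> = cohomology_class X d"
    "\<forall>W. (\<exists>j\<in>set js. vanishes_on (subtopology X W) (c' j)) \<longrightarrow> vanishes_on (subtopology X W) d"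
    using product_of_classes[OF c'(1)] by auto
  have vd: "vanishes_on (subtopology X V) d" if "V \<in> W ` set js" for V
    using that d(3) c'(3) by auto
  have "d \<in> coboundaries X"
    by (rule cocycle_vanishing_on_small_simplices[OF d(1), of "W ` set js"])
      (use cover opn vd in \<open>auto simp: vanishes_on_def\<close>)
  then have "cohomology_class X d = \<zero>\<^bsub>singular_cohomology X\<^esub>"
    by (simp add: cohomology_class_coboundary zero_singular_cohomology)
  moreover have "map (\<lambda>j. cohomology_class X (c' j)) js = map (\<lambda>j. cohomology_class X (c j)) js"
    using c'(2) by simp
  ultimately show ?thesis
    using d(2) by (simp only:)
qed

lemma cohomology_map_zeroD:
  assumes u: "u = cohomology_class Y c"
    and z: "cohomology_map X f u = \<zero>\<^bsub>singular_cohomology X\<^esub>"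
  shows "cochain_pullback X f c \<in> coboundaries X"
proof -
  have "c \<in> u" unfolding u by (rule cohomology_class_self)
  then have "cochain_pullback X f c \<in> cohomology_map X f u"
    unfolding cohomology_map_def cohomology_class_def[symmetric]
    by (rule UN_I) (rule cohomology_class_self)
  then show ?thesis unfolding z zero_singular_cohomology .
qed

section \<open>Pullbacks of cochains\<close>

lemma cochain_pullback_in_singular_cochains:
  assumes "z \<in> singular_cochains Y"
  shows "cochain_pullback X f z \<in> singular_cochains X"
proof -
  have "finite {n. cochain_pullback X f z n \<noteq> (\<lambda>\<sigma>. 0)}"
    by (rule rev_finite_subset[of "{n. z n \<noteq> (\<lambda>\<sigma>. 0)}"])
      (use assms in \<open>auto simp: singular_cochains_def cochain_pullback_def fun_eq_iff\<close>)
  then show ?thesis by (simp add: singular_cochains_def cochain_pullback_def)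
qed

lemma cochain_eval_pullback:
  assumes "singular_chain n X c"
  shows "cochain_eval (cochain_pullback X f z n) c = cochain_eval (z n) (chain_map n f c)"
  unfolding chain_map_def cochain_eval_extend
  using assms by (intro cochain_eval_cong) (auto simp: cochain_pullback_def singular_chain_def)

lemma cochain_differential_pullback:
  assumes "continuous_map X Y f"
  shows "cochain_differential X (cochain_pullback X f z) = cochain_pullback X f (cochain_differential Y z)"
proof (intro ext)
  fix n \<sigma>
  show "cochain_differential X (cochain_pullback X f z) n \<sigma> = cochain_pullback X f (cochain_differential Y z) n \<sigma>"
  proof (cases "singular_simplex n X \<sigma> \<and> n \<noteq> 0")
    case True
    then obtain m where m: "n = Suc m" by (cases n) auto
    have c: "singular_chain (Suc m) X (frag_of \<sigma>)" using True m by (simp add: singular_chain_of)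
    have "singular_simplex (Suc m) Y (simplex_map (Suc m) f \<sigma>)"
      using True m assms by (auto intro: singular_simplex_simplex_map)
    moreover have "chain_map m f (chain_boundary (Suc m) (frag_of \<sigma>)) =
        chain_boundary (Suc m) (frag_of (simplex_map (Suc m) f \<sigma>))"
      using chain_boundary_chain_map[OF c, of f] by simp
    ultimately show ?thesis
      using True cochain_eval_pullback[OF singular_chain_boundary_alt[OF c], of f z]
      by (simp add: m cochain_pullback_def[of X f "cochain_differential Y z"] cochain_differential_Suc)
  qed (auto simp: cochain_differential_def cochain_pullback_def)
qed

lemma cochain_pullback_compose:
  assumes "continuous_map X Y f"
  shows "cochain_pullback X f (cochain_pullback Y g z) = cochain_pullback X (g \<circ> f) z"
  using singular_simplex_simplex_map[OF _ assms]
  by (intro ext) (auto simp: cochain_pullback_def simplex_map_compose)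

lemma cochain_pullback_cong:
  assumes "\<And>x. x \<in> topspace X \<Longrightarrow> f x = g x"
  shows "cochain_pullback X f z = cochain_pullback X g z"
proof -
  have "simplex_map n f \<sigma> = simplex_map n g \<sigma>" if "singular_simplex n X \<sigma>" for n \<sigma>
    using that assms by (rule simplex_map_eq)
  then show ?thesis by (intro ext) (simp add: cochain_pullback_def)
qed

lemma cochain_pullback_coboundary:
  assumes "z \<in> coboundaries Y" "continuous_map X Y f"
  shows "cochain_pullback X f z \<in> coboundaries X"
proof -
  obtain e where e: "e \<in> singular_cochains Y" "z = cochain_differential Y e"
    using assms(1) by (auto simp: coboundaries_def)
  show ?thesis
    unfolding coboundaries_def e(2) cochain_differential_pullback[OF assms(2), symmetric]
    by (rule imageI) (rule cochain_pullback_in_singular_cochains[OF e(1)])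
qed

section \<open>Homotopy invariance on the level of cochains\<close>

abbreviation simplex_space :: "nat \<Rightarrow> (nat \<Rightarrow> real) topology" where
  "simplex_space n \<equiv> subtopology (powertop_real UNIV) (standard_simplex n)"

abbreviation simplex_id :: "nat \<Rightarrow> (nat \<Rightarrow> real) \<Rightarrow> nat \<Rightarrow> real" where
  "simplex_id n \<equiv> restrict id (standard_simplex n)"

lemma singular_simplex_id: "singular_simplex n (simplex_space n) (simplex_id n)"
  using simplicial_imp_singular_simplex simplicial_simplex_id by blast

lemma contractible_simplex_space: "contractible_space (simplex_space n)"
proof -
  let ?e = "\<lambda>i. if i = (0::nat) then 1 else (0::real)"
  have e: "?e \<in> standard_simplex n"
    using basis_in_standard_simplex[of 0 n] by simp
  let ?h = "\<lambda>(u, x). \<lambda>i. (1 - u) * x i + u * ?e i"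
  have c: "continuous_map (prod_topology unit_interval (simplex_space n)) euclideanreal (\<lambda>z. snd z i)" for i
    using continuous_map_compose[OF continuous_map_snd
        continuous_map_from_subtopology[OF continuous_map_product_projection[of i UNIV "\<lambda>_. euclideanreal"]]]
    by (simp add: o_def)
  have u: "continuous_map (prod_topology unit_interval (simplex_space n)) euclideanreal fst"
    using continuous_map_fst continuous_map_into_fulltopology by blast
  have "continuous_map (prod_topology unit_interval (simplex_space n)) (simplex_space n) ?h"
    unfolding continuous_map_in_subtopology
  proof
    show "continuous_map (prod_topology unit_interval (simplex_space n)) (powertop_real UNIV) ?h"
      unfolding continuous_map_componentwise_UNIV case_prod_beta
      by (intro allI continuous_intros c u)
    show "?h \<in> topspace (prod_topology unit_interval (simplex_space n)) \<rightarrow> standard_simplex n"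
      using convex_standard_simplex[OF _ e] by auto
  qed
  then have "homotopic_with (\<lambda>x. True) (simplex_space n) (simplex_space n) id (\<lambda>x. ?e)"
    unfolding homotopic_with_def by (intro exI[of _ ?h]) auto
  then show ?thesis unfolding contractible_space_def by blast
qed

text \<open>A cycle is homologous to its image under a constant map, and a cycle of positive degree in a
  one-point space bounds.\<close>

lemma contractible_cycle_bounds:
  assumes X: "contractible_space X" and c: "singular_chain (Suc n) X c" "chain_boundary (Suc n) c = 0"
  shows "\<exists>d. singular_chain (Suc (Suc n)) X d \<and> chain_boundary (Suc (Suc n)) d = c"
proof (cases "topspace X = {}")
  case True
  then have "c = 0" using c(1) by (simp add: singular_chain_empty)
  then show ?thesis by (intro exI[of _ 0]) auto
next
  case False
  obtain a where a: "homotopic_with (\<lambda>x. True) X X id (\<lambda>x. a)"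
    using X by (auto simp: contractible_space_def)
  have aX: "a \<in> topspace X"
    using homotopic_with_imp_continuous_maps[OF a] False by (auto simp: continuous_map_def)
  have "homotopic_with (\<lambda>h. h \<in> {} \<rightarrow> {}) X X id (\<lambda>x. a)"
    using a by (rule homotopic_with_mono) auto
  moreover have cyc: "singular_relcycle (Suc n) X {} c"
    using c by (simp add: singular_cycle)
  ultimately have "homologous_rel (Suc n) X {} (chain_map (Suc n) id c) (chain_map (Suc n) (\<lambda>x. a) c)"
    by (rule homotopic_imp_homologous_rel_chain_maps)
  then have 1: "singular_relboundary (Suc n) X {} (c - chain_map (Suc n) (\<lambda>x. a) c)"
    using chain_map_ident[OF c(1)] by (simp add: homologous_rel_def)
  have "singular_relcycle (Suc n) (subtopology X {a}) {} (chain_map (Suc n) (\<lambda>x. a) c)"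
    by (rule singular_relcycle_chain_map[OF cyc]) (use aX in \<open>auto simp: continuous_map_in_subtopology\<close>)
  then have "singular_relboundary (Suc n) (subtopology X {a}) {} (chain_map (Suc n) (\<lambda>x. a) c)"
    using aX by (subst singular_boundary_eq_cycle_singleton[of _ a]) auto
  then have "singular_relboundary (Suc n) X {} (chain_map (Suc n) (\<lambda>x. a) c)"
    using singular_boundary_mono[of "{a}" "topspace X" "Suc n" X] aX by simp
  from singular_relboundary_add[OF 1 this] show ?thesis
    by (simp add: singular_boundary)
qed

text \<open>The value on \<open>\<sigma>\<close> of the natural transformation from \<open>n\<close>-chains of \<open>X\<close> to \<open>(n + 1)\<close>-chains of
  \<open>I \<times> X\<close> whose value on the universal simplex is \<open>d\<close>.\<close>

definition cylinder_chain :: "nat \<Rightarrow> (real \<times> (nat \<Rightarrow> real)) chain \<Rightarrow> ((nat \<Rightarrow> real) \<Rightarrow> 'a) \<Rightarrow> (real \<times> 'a) chain" where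
  "cylinder_chain n d \<sigma> = chain_map (Suc n) (map_prod id \<sigma>) d"

text \<open>The chain homotopy identity between the two ends of the cylinder, for the universal \<open>n\<close>-simplex
  alone: \<open>d\<close> is the prism over it and \<open>d'\<close> the prism over the universal \<open>(n - 1)\<close>-simplex, which
  is placed over the faces. For \<open>n = 0\<close> there are no faces, and
  the sum over them is empty.\<close>

definition prism_model ::
  "nat \<Rightarrow> (real \<times> (nat \<Rightarrow> real)) chain \<Rightarrow> (real \<times> (nat \<Rightarrow> real)) chain \<Rightarrow> bool" where
  "prism_model n d' d \<longleftrightarrow>
     singular_chain (Suc (n - 1)) (prod_topology unit_interval (simplex_space (n - 1))) d' \<and>
     singular_chain (Suc n) (prod_topology unit_interval (simplex_space n)) d \<and>
     chain_boundary (Suc n) d =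
       chain_map n (Pair 1) (frag_of (simplex_id n)) - chain_map n (Pair 0) (frag_of (simplex_id n))
       - frag_extend (cylinder_chain (n - 1) d') (chain_boundary n (frag_of (simplex_id n)))"

lemma continuous_map_Pair:
  "a \<in> topspace A \<Longrightarrow> continuous_map X (prod_topology A X) (Pair a)"
  by (simp add: continuous_map_pairwise o_def)

lemma continuous_map_cylinder:
  assumes "continuous_map X Y f"
  shows "continuous_map (prod_topology A X) (prod_topology A Y) (map_prod id f)"
  using continuous_map_compose[OF continuous_map_snd assms]
  by (simp add: continuous_map_pairwise o_def continuous_map_fst map_prod_def case_prod_beta)

lemma singular_chain_cylinder_chain:
  assumes "singular_chain (Suc n) (prod_topology unit_interval (simplex_space n)) d" "singular_simplex n X \<sigma>"
  shows "singular_chain (Suc n) (prod_topology unit_interval X) (cylinder_chain n d \<sigma>)"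
  unfolding cylinder_chain_def
  by (rule singular_chain_chain_map[OF assms(1)])
    (use assms(2) in \<open>simp add: singular_simplex_def continuous_map_cylinder\<close>)

lemma cylinder_chain_natural:
  assumes d: "singular_chain (Suc n) (prod_topology unit_interval (simplex_space n)) d"
  shows "chain_map (Suc n) (map_prod id f) (frag_extend (cylinder_chain n d) c) =
         frag_extend (cylinder_chain n d) (chain_map n f c)"
  using subset_UNIV
proof (induction c rule: frag_induction)
  case (one \<tau>)
  have "chain_map (Suc n) (map_prod id f) (chain_map (Suc n) (map_prod id \<tau>) d) =
      chain_map (Suc n) (map_prod id (simplex_map n f \<tau>)) d"
    unfolding chain_map_compose[symmetric, THEN fun_cong, unfolded o_apply[of "chain_map _ _"]]
    by (rule chain_map_eq[OF d]) (auto simp: simplex_map_def)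
  then show ?case by (simp add: cylinder_chain_def id_def)
next
  case (diff a b)
  then show ?case by (simp add: frag_extend_diff chain_map_diff)
qed auto

text \<open>By naturality the identity for the universal simplex gives the identity for every simplex of every
  space.\<close>

lemma boundary_cylinder_chain:
  assumes m: "prism_model n d' d" and \<sigma>: "singular_simplex n X \<sigma>"
  shows "chain_boundary (Suc n) (cylinder_chain n d \<sigma>) =
       chain_map n (Pair 1) (frag_of \<sigma>) - chain_map n (Pair 0) (frag_of \<sigma>)
       - frag_extend (cylinder_chain (n - 1) d') (chain_boundary n (frag_of \<sigma>))"
proof -
  have d: "singular_chain (Suc n) (prod_topology unit_interval (simplex_space n)) d"
    and d': "singular_chain (Suc (n - 1)) (prod_topology unit_interval (simplex_space (n - 1))) d'"
    using m by (auto simp: prism_model_def)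
  have end_eq: "chain_map n (map_prod id \<sigma>) (chain_map n (Pair a) (frag_of (simplex_id n))) =
      chain_map n (Pair a) (frag_of \<sigma>)" for a :: real
    by (simp add: simplex_map_def frag_of_eq) (auto simp: restrict_def fun_eq_iff)
  have faces: "chain_map n (map_prod id \<sigma>) (frag_extend (cylinder_chain (n - 1) d')
        (chain_boundary n (frag_of (simplex_id n)))) =
      frag_extend (cylinder_chain (n - 1) d') (chain_boundary n (frag_of \<sigma>))"
  proof (cases n)
    case 0
    then show ?thesis by (simp add: chain_boundary_def)
  next
    case (Suc k)
    have \<iota>: "singular_chain n (simplex_space n) (frag_of (simplex_id n))"
      by (simp add: singular_chain_of singular_simplex_id)
    have "chain_map (n - 1) \<sigma> (chain_boundary n (frag_of (simplex_id n))) = chain_boundary n (frag_of \<sigma>)"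
      using chain_boundary_chain_map[OF \<iota>, of \<sigma>] singular_simplex_chain_map_id[OF \<sigma>] by simp
    then show ?thesis
      using cylinder_chain_natural[OF d', of \<sigma>] Suc by simp
  qed
  show ?thesis
    using m chain_boundary_chain_map[OF d, of "map_prod id \<sigma>"] end_eq faces
    by (simp add: prism_model_def cylinder_chain_def chain_map_diff)
qed

lemma boundary_cylinder_chains:
  assumes m: "prism_model n d' d" and c: "singular_chain n X c"
  shows "chain_boundary (Suc n) (frag_extend (cylinder_chain n d) c) =
       chain_map n (Pair 1) c - chain_map n (Pair 0) c
       - frag_extend (cylinder_chain (n - 1) d') (chain_boundary n c)"
  using c unfolding singular_chain_def
proof (induction c rule: frag_induction)
  case (one \<sigma>)
  then show ?case using boundary_cylinder_chain[OF m, of X \<sigma>] by simp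
next
  case (diff a b)
  then show ?case by (simp add: frag_extend_diff chain_map_diff chain_boundary_diff)
qed auto

text \<open>The two points at the ends of \<open>I \<times> \<Delta>\<^sup>0\<close> are homologous because the two end inclusions are
  homotopic; in degree \<open>0\<close> being a cycle would not suffice.\<close>

lemma prism_model_0: "\<exists>d. prism_model 0 0 d"
proof -
  let ?\<iota> = "frag_of (simplex_id 0)" and ?Y = "prod_topology unit_interval (simplex_space 0)"
  have "homotopic_with (\<lambda>h. h \<in> {} \<rightarrow> {}) (simplex_space 0) ?Y (Pair 1) (Pair (0::real))"
    unfolding homotopic_with_def
    by (rule exI[of _ "\<lambda>(t, x). (1 - t, x)"])
      (auto simp: continuous_map_pairwise continuous_map_in_subtopology o_def case_prod_beta
        intro!: continuous_intros continuous_map_fst continuous_map_snd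
          continuous_map_into_fulltopology[OF continuous_map_fst]
          continuous_map_into_fulltopology[OF continuous_map_snd])
  moreover have "singular_relcycle 0 (simplex_space 0) {} ?\<iota>"
    by (simp add: singular_cycle singular_chain_of singular_simplex_id chain_boundary_def)
  ultimately have "homologous_rel 0 ?Y {} (chain_map 0 (Pair 1) ?\<iota>) (chain_map 0 (Pair 0) ?\<iota>)"
    by (rule homotopic_imp_homologous_rel_chain_maps)
  then show ?thesis
    unfolding homologous_rel_def singular_boundary prism_model_def by (simp add: chain_boundary_def)
qed

text \<open>The boundary prescribed for the next prism is a cycle, by the identity one degree below applied to
  the chain \<open>\<partial>\<Delta>\<^sup>n\<^sup>+\<^sup>1\<close> together with \<open>\<partial>\<partial> = 0\<close>. It bounds as \<open>I \<times> \<Delta>\<^sup>n\<^sup>+\<^sup>1\<close> is contractible.\<close>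

lemma prism_model_Suc:
  assumes m: "prism_model n d' d"
  shows "\<exists>e. prism_model (Suc n) d e"
proof -
  let ?\<iota> = "frag_of (simplex_id (Suc n))" and ?Y = "prod_topology unit_interval (simplex_space (Suc n))"
  let ?c = "chain_map (Suc n) (Pair 1) ?\<iota> - chain_map (Suc n) (Pair 0) ?\<iota>
       - frag_extend (cylinder_chain n d) (chain_boundary (Suc n) ?\<iota>)"
  have d: "singular_chain (Suc n) (prod_topology unit_interval (simplex_space n)) d"
    using m by (simp add: prism_model_def)
  have \<iota>: "singular_chain (Suc n) (simplex_space (Suc n)) ?\<iota>"
    by (simp add: singular_chain_of singular_simplex_id)
  have \<partial>: "singular_chain n (simplex_space (Suc n)) (chain_boundary (Suc n) ?\<iota>)"
    by (rule singular_chain_boundary_alt[OF \<iota>])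
  have "singular_chain (Suc n) ?Y ?c"
  proof (intro singular_chain_diff)
    show "singular_chain (Suc n) ?Y (chain_map (Suc n) (Pair 1) ?\<iota>)"
      "singular_chain (Suc n) ?Y (chain_map (Suc n) (Pair 0) ?\<iota>)"
      by (rule singular_chain_chain_map[OF \<iota>], rule continuous_map_Pair, simp)+
    show "singular_chain (Suc n) ?Y (frag_extend (cylinder_chain n d) (chain_boundary (Suc n) ?\<iota>))"
      using \<partial> singular_chain_cylinder_chain[OF d]
      by (intro singular_chain_extend) (auto simp: singular_chain_def)
  qed
  moreover have "chain_boundary (Suc n) ?c = 0"
  proof -
    have "chain_boundary n (chain_boundary (Suc n) ?\<iota>) = 0"
      using chain_boundary_boundary[OF \<iota>] by simp
    then show ?thesis
      using boundary_cylinder_chains[OF m \<partial>]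
      by (simp add: chain_boundary_diff chain_boundary_chain_map[OF \<iota>] del: chain_map_of)
  qed
  moreover have "contractible_space ?Y"
    by (simp add: contractible_space_prod_topology contractible_simplex_space convex_imp_contractible)
  ultimately obtain e where "singular_chain (Suc (Suc n)) ?Y e" "chain_boundary (Suc (Suc n)) e = ?c"
    using contractible_cycle_bounds by blast
  then show ?thesis using d by (auto simp: prism_model_def)
qed

text \<open>Prisms are chosen degree by degree, as the one over \<open>\<Delta>\<^sup>n\<^sup>+\<^sup>1\<close> has to fit the one over
  \<open>\<Delta>\<^sup>n\<close>.\<close>

lemma prism_models_exist:
  "\<exists>d. \<forall>n. \<exists>d'. (n > 0 \<longrightarrow> d' = d (n - 1)) \<and> prism_model n d' (d n)"
proof -
  have "\<exists>d. \<forall>n. (\<exists>d'. prism_model n d' (d n)) \<and> prism_model (Suc n) (d n) (d (Suc n))"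
    by (rule dependent_nat_choice) (use prism_model_0 prism_model_Suc in blast)+
  then obtain d where d: "\<And>n. \<exists>d'. prism_model n d' (d n)" "\<And>n. prism_model (Suc n) (d n) (d (Suc n))"
    by blast
  have "\<exists>d'. (n > 0 \<longrightarrow> d' = d (n - 1)) \<and> prism_model n d' (d n)" for n
    using d by (cases n) auto
  then show ?thesis by blast
qed

text \<open>Pushing the prisms forward along the homotopy gives a chain homotopy between the two maps, and
  evaluating \<open>z\<close> on it gives the primitive.\<close>

lemma cochain_pullback_homotopic:
  fixes z :: "('b, 'r::comm_ring_1) cochain"
  assumes hom: "homotopic_with (\<lambda>h. True) X Y f g" and z: "z \<in> singular_cocycles Y"
  shows "(\<lambda>n \<sigma>. cochain_pullback X g z n \<sigma> - cochain_pullback X f z n \<sigma>) \<in> coboundaries X"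
proof -
  obtain H where H: "continuous_map (prod_topology unit_interval X) Y H"
    "\<And>x. H (0, x) = f x" "\<And>x. H (1, x) = g x"
    using hom by (auto simp: homotopic_with_def)
  obtain d where "\<forall>n. \<exists>d'. (n > 0 \<longrightarrow> d' = d (n - 1)) \<and> prism_model n d' (d n)"
    using prism_models_exist by blast
  then obtain d' where d': "\<And>n. n > 0 \<Longrightarrow> d' n = d (n - 1)" and m: "\<And>n. prism_model n (d' n) (d n)"
    by metis
  define D where "D = (\<lambda>n \<sigma>. chain_map (Suc n) H (cylinder_chain n (d n) \<sigma>))"
  have D_chain: "singular_chain (Suc n) Y (D n \<sigma>)" if "singular_simplex n X \<sigma>" for n \<sigma>
    unfolding D_def
    by (rule singular_chain_chain_map[OF singular_chain_cylinder_chain[OF _ that] H(1)])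
      (use m[of n] in \<open>simp add: prism_model_def\<close>)
  have D_extend: "frag_extend (D n) c = chain_map (Suc n) H (frag_extend (cylinder_chain n (d n)) c)" for n c
    unfolding D_def using subset_UNIV
    by (induction c rule: frag_induction) (auto simp: frag_extend_diff chain_map_diff)
  have ends: "chain_map n H (chain_map n (Pair 0) c) = chain_map n f c"
    "chain_map n H (chain_map n (Pair 1) c) = chain_map n g c" for n c
    using H(2,3) by (simp_all add: chain_map_compose[symmetric, THEN fun_cong, unfolded o_apply[of "chain_map _ _"]]) (simp_all add: o_def)
  have D_boundary: "chain_boundary (Suc n) (D n \<sigma>) = frag_of (simplex_map n g \<sigma>) - frag_of (simplex_map n f \<sigma>)
      - chain_map n H (frag_extend (cylinder_chain (n - 1) (d' n)) (chain_boundary n (frag_of \<sigma>)))"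
    if \<sigma>: "singular_simplex n X \<sigma>" for n \<sigma>
  proof -
    have "chain_boundary (Suc n) (D n \<sigma>) = chain_map n H (chain_boundary (Suc n) (cylinder_chain n (d n) \<sigma>))"
      unfolding D_def
      using chain_boundary_chain_map[OF singular_chain_cylinder_chain[OF _ \<sigma>, of "d n"], of H] m[of n]
      by (simp add: prism_model_def)
    then show ?thesis
      by (simp add: boundary_cylinder_chain[OF m \<sigma>] chain_map_diff ends del: chain_map_of)
        (simp add: chain_map_of)
  qed
  show ?thesis
  proof (rule coboundaryI[where b = "\<lambda>n \<sigma>. cochain_eval (z (Suc n)) (D n \<sigma>)"])
    have zc: "z \<in> singular_cochains Y" using singular_cocyclesD(1)[OF z] .
    show "(\<lambda>n \<sigma>. cochain_pullback X g z n \<sigma> - cochain_pullback X f z n \<sigma>) \<in> singular_cochains X"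
      using singular_cochains_add[OF cochain_pullback_in_singular_cochains[OF zc, of X g]
          singular_cochains_uminus[OF cochain_pullback_in_singular_cochains[OF zc, of X f]]] by simp
    have z_boundary: "cochain_eval (z n) (chain_boundary (Suc n) (D n \<sigma>)) = 0" if "singular_simplex n X \<sigma>" for n \<sigma>
      by (rule cocycle_eval_boundary[OF z D_chain[OF that]])
    show "cochain_pullback X g z 0 \<sigma> - cochain_pullback X f z 0 \<sigma> = 0" if "singular_simplex 0 X \<sigma>" for \<sigma>
      using z_boundary[OF that] that
      by (simp add: D_boundary chain_boundary_def[of 0] cochain_eval_diff cochain_pullback_def)
    show "cochain_eval (\<lambda>\<sigma>. cochain_eval (z (Suc n)) (D n \<sigma>)) (chain_boundary (Suc n) (frag_of \<sigma>)) =
        cochain_pullback X g z (Suc n) \<sigma> - cochain_pullback X f z (Suc n) \<sigma>"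
      if \<sigma>: "singular_simplex (Suc n) X \<sigma>" for n \<sigma>
      using z_boundary[OF \<sigma>] \<sigma> d'[of "Suc n"]
      by (simp add: D_boundary cochain_eval_diff cochain_pullback_def flip: D_extend cochain_eval_extend)
    have "{n. \<exists>\<sigma>. singular_simplex n X \<sigma> \<and> cochain_eval (z (Suc n)) (D n \<sigma>) \<noteq> 0} \<subseteq> Suc -` {n. z n \<noteq> (\<lambda>\<sigma>. 0)}"
      by (auto intro: cochain_eval_eq_0)
    then show "finite {n. \<exists>\<sigma>. singular_simplex n X \<sigma> \<and> cochain_eval (z (Suc n)) (D n \<sigma>) \<noteq> 0}"
      by (rule finite_subset) (use zc in \<open>intro finite_vimageI; simp add: singular_cochains_def\<close>)
  qed
qed

section \<open>Homotopy orbit spaces over invariant open sets\<close>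

lemma homotopy_orbit_rel_iff:
  "((a, x), (b, y)) \<in> homotopy_orbit_rel \<Gamma> P \<rho> X \<phi> \<longleftrightarrow>
     b \<in> topspace P \<and> x \<in> topspace X \<and> (\<exists>g \<in> carrier \<Gamma>. a = \<rho> b g \<and> y = \<phi> g x)"
  by (auto simp: homotopy_orbit_rel_def)

abbreviation orbit_class ::
  "('g, 'm) monoid_scheme \<Rightarrow> 'z topology \<Rightarrow> ('z \<Rightarrow> 'g \<Rightarrow> 'z) \<Rightarrow>
     'x topology \<Rightarrow> ('g \<Rightarrow> 'x \<Rightarrow> 'x) \<Rightarrow> 'z \<times> 'x \<Rightarrow> ('z \<times> 'x) set" where
  "orbit_class \<Gamma> P \<rho> X \<phi> z \<equiv> homotopy_orbit_rel \<Gamma> P \<rho> X \<phi> `` {z}"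

lemma quotient_map_orbit_class:
  "quotient_map (prod_topology P X) (homotopy_orbit_space \<Gamma> P \<rho> X \<phi>) (orbit_class \<Gamma> P \<rho> X \<phi>)"
  unfolding homotopy_orbit_space_def by (rule quotient_map_quotient_topology)

locale homotopy_orbits =
  fixes \<Gamma> :: "('g, 'm) monoid_scheme" and T :: "'g topology"
    and P :: "'z topology" and \<rho> :: "'z \<Rightarrow> 'g \<Rightarrow> 'z"
    and W :: "'w topology" and \<pi> :: "'z \<Rightarrow> 'w"
  assumes top_group: "topological_group \<Gamma> T" and principal: "principal_bundle \<Gamma> T P \<rho> W \<pi>"
begin

lemma orbit_class_eq:
  assumes "G_space \<Gamma> T X \<phi>" "(z, z') \<in> homotopy_orbit_rel \<Gamma> P \<rho> X \<phi>"
  shows "orbit_class \<Gamma> P \<rho> X \<phi> z = orbit_class \<Gamma> P \<rho> X \<phi> z'"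
  using equiv_class_eq[OF equiv_homotopy_orbit_rel[OF top_group principal assms(1)] assms(2)] .

lemma orbit_class_self:
  assumes "G_space \<Gamma> T X \<phi>" "z \<in> topspace (prod_topology P X)"
  shows "z \<in> orbit_class \<Gamma> P \<rho> X \<phi> z"
  using equiv_class_self[OF equiv_homotopy_orbit_rel[OF top_group principal assms(1)] assms(2)] .

text \<open>Every representative of the class of \<open>(e, x)\<close> has its second component in the orbit of \<open>x\<close>, hence
  in \<open>U\<close>. So a map defined on \<open>U\<close> alone induces one on a subspace of the homotopy orbit space
  of \<open>X\<close>.\<close>

lemma homotopy_orbit_map_class:
  assumes X: "G_space \<Gamma> T X \<phi>" and Y: "G_space \<Gamma> T Y \<psi>"
    and U: "U \<subseteq> topspace X" "\<And>g. g \<in> carrier \<Gamma> \<Longrightarrow> \<phi> g ` U \<subseteq> U"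
    and f: "\<And>x. x \<in> U \<Longrightarrow> f x \<in> topspace Y"
      "\<And>g x. g \<in> carrier \<Gamma> \<Longrightarrow> x \<in> U \<Longrightarrow> f (\<phi> g x) = \<psi> g (f x)"
    and e: "e \<in> topspace P" and x: "x \<in> U"
  shows "homotopy_orbit_map \<Gamma> P \<rho> Y \<psi> f (orbit_class \<Gamma> P \<rho> X \<phi> (e, x)) = orbit_class \<Gamma> P \<rho> Y \<psi> (e, f x)"
proof -
  have "orbit_class \<Gamma> P \<rho> Y \<psi> (e', f x') = orbit_class \<Gamma> P \<rho> Y \<psi> (e, f x)"
    if ex: "(e', x') \<in> orbit_class \<Gamma> P \<rho> X \<phi> (e, x)" for e' x'
  proof -
    obtain g where g: "e' \<in> topspace P" "g \<in> carrier \<Gamma>" "e = \<rho> e' g" "x' = \<phi> g x"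
      using ex by (auto simp: homotopy_orbit_rel_iff)
    then have "((e, f x), (e', f x')) \<in> homotopy_orbit_rel \<Gamma> P \<rho> Y \<psi>"
      using f x by (auto simp: homotopy_orbit_rel_iff)
    from orbit_class_eq[OF Y this] show ?thesis by simp
  qed
  then have "(\<lambda>(e', x'). orbit_class \<Gamma> P \<rho> Y \<psi> (e', f x')) ` orbit_class \<Gamma> P \<rho> X \<phi> (e, x) \<subseteq>
      {orbit_class \<Gamma> P \<rho> Y \<psi> (e, f x)}"
    by (simp add: image_subset_iff split_beta)
  moreover have "(e, x) \<in> orbit_class \<Gamma> P \<rho> X \<phi> (e, x)"
    using orbit_class_self[OF X] e x U(1) by auto
  ultimately have "(\<lambda>(e', x'). orbit_class \<Gamma> P \<rho> Y \<psi> (e', f x')) ` orbit_class \<Gamma> P \<rho> X \<phi> (e, x) =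
      {orbit_class \<Gamma> P \<rho> Y \<psi> (e, f x)}"
    by (metis empty_iff image_is_empty subset_singletonD)
  then show ?thesis
    by (simp add: homotopy_orbit_map_def)
qed

text \<open>The image of the homotopy orbit space of \<open>U\<close> in that of \<open>X\<close>.\<close>

definition orbit_image :: "'x topology \<Rightarrow> ('g \<Rightarrow> 'x \<Rightarrow> 'x) \<Rightarrow> 'x set \<Rightarrow> ('z \<times> 'x) set set" where
  "orbit_image X \<phi> U = orbit_class \<Gamma> P \<rho> X \<phi> ` (topspace P \<times> U)"

text \<open>\<open>P \<times> U\<close> is open and saturated, as \<open>U\<close> is invariant, so the quotient map restricts to it.\<close>

lemma
  assumes X: "G_space \<Gamma> T X \<phi>" and U: "openin X U" "\<And>g. g \<in> carrier \<Gamma> \<Longrightarrow> \<phi> g ` U \<subseteq> U"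
  shows openin_orbit_image: "openin (homotopy_orbit_space \<Gamma> P \<rho> X \<phi>) (orbit_image X \<phi> U)"
    and quotient_map_orbit_image: "quotient_map (prod_topology P (subtopology X U))
       (subtopology (homotopy_orbit_space \<Gamma> P \<rho> X \<phi>) (orbit_image X \<phi> U)) (orbit_class \<Gamma> P \<rho> X \<phi>)"
proof -
  let ?q = "orbit_class \<Gamma> P \<rho> X \<phi>"
  have UX: "U \<subseteq> topspace X" using U(1) by (rule openin_subset)
  have saturated: "{z \<in> topspace (prod_topology P X). ?q z \<in> orbit_image X \<phi> U} = topspace P \<times> U"
  proof (intro subset_antisym subsetI)
    fix z assume z: "z \<in> {z \<in> topspace (prod_topology P X). ?q z \<in> orbit_image X \<phi> U}"
    then obtain e x e' x' where "z = (e, x)" "e \<in> topspace P" "x \<in> topspace X"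
      "e' \<in> topspace P" "x' \<in> U" "?q (e, x) = ?q (e', x')"
      by (auto simp: orbit_image_def)
    then have "((e', x'), (e, x)) \<in> homotopy_orbit_rel \<Gamma> P \<rho> X \<phi>"
      using orbit_class_self[OF X, of "(e, x)"] by auto
    then show "z \<in> topspace P \<times> U"
      using \<open>z = (e, x)\<close> \<open>x' \<in> U\<close> U(2) by (auto simp: homotopy_orbit_rel_iff)
  qed (use UX in \<open>auto simp: orbit_image_def\<close>)
  have "openin (prod_topology P X) (topspace P \<times> U)"
    using U(1) by (simp add: openin_prod_Times_iff)
  moreover have "orbit_image X \<phi> U \<subseteq> ?q ` topspace (prod_topology P X)"
    using UX by (auto simp: orbit_image_def)
  ultimately show o: "openin (homotopy_orbit_space \<Gamma> P \<rho> X \<phi>) (orbit_image X \<phi> U)"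
    by (simp add: homotopy_orbit_space_def openin_quotient_topology saturated del: topspace_prod_topology)
  have "quotient_map (subtopology (prod_topology P X) (topspace P \<times> U))
       (subtopology (homotopy_orbit_space \<Gamma> P \<rho> X \<phi>) (orbit_image X \<phi> U)) ?q"
    by (rule quotient_map_restriction[OF quotient_map_orbit_class saturated]) (use o in simp)
  then show "quotient_map (prod_topology P (subtopology X U))
       (subtopology (homotopy_orbit_space \<Gamma> P \<rho> X \<phi>) (orbit_image X \<phi> U)) ?q"
    by (simp add: subtopology_Times)
qed

text \<open>The homotopy descends because the interval is locally compact, so that its product with the
  quotient map is again a quotient map.\<close>

lemma homotopic_homotopy_orbit_map:
  assumes X: "G_space \<Gamma> T X \<phi>" and Y: "G_space \<Gamma> T Y \<psi>"
    and U: "openin X U" "\<And>g. g \<in> carrier \<Gamma> \<Longrightarrow> \<phi> g ` U \<subseteq> U"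
    and hom: "G_homotopic \<Gamma> (subtopology X U) \<phi> Y \<psi> f f'"
  shows "homotopic_with (\<lambda>h. True)
     (subtopology (homotopy_orbit_space \<Gamma> P \<rho> X \<phi>) (orbit_image X \<phi> U)) (homotopy_orbit_space \<Gamma> P \<rho> Y \<psi>)
     (homotopy_orbit_map \<Gamma> P \<rho> Y \<psi> f) (homotopy_orbit_map \<Gamma> P \<rho> Y \<psi> f')"
proof -
  let ?qX = "orbit_class \<Gamma> P \<rho> X \<phi>" and ?qY = "orbit_class \<Gamma> P \<rho> Y \<psi>"
  let ?W = "subtopology (homotopy_orbit_space \<Gamma> P \<rho> X \<phi>) (orbit_image X \<phi> U)"
  let ?PU = "prod_topology P (subtopology X U)"
  have UX: "U \<subseteq> topspace X" using U(1) by (rule openin_subset)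
  obtain H where H: "G_map \<Gamma> (prod_topology unit_interval (subtopology X U)) (cylinder_action \<phi>) Y \<psi> H"
    and H01: "\<forall>x \<in> topspace (subtopology X U). H (0, x) = f x \<and> H (1, x) = f' x"
    using hom by (auto simp: G_homotopic_def)
  have Hc: "continuous_map (prod_topology unit_interval (subtopology X U)) Y H"
    and He: "\<And>g t x. g \<in> carrier \<Gamma> \<Longrightarrow> t \<in> {0..1} \<Longrightarrow> x \<in> U \<Longrightarrow> H (t, \<phi> g x) = \<psi> g (H (t, x))"
    using H UX by (auto simp: G_map_def cylinder_action_def)
  have HY: "H (t, x) \<in> topspace Y" if "t \<in> {0..1}" "x \<in> U" for t x
    using Hc that UX by (auto simp: continuous_map_def Pi_iff)
  define K where "K = (\<lambda>(t, C). homotopy_orbit_map \<Gamma> P \<rho> Y \<psi> (\<lambda>x. H (t, x)) C)"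
  have K: "K (t, ?qX (e, x)) = ?qY (e, H (t, x))" if "t \<in> {0..1}" "e \<in> topspace P" "x \<in> U" for t e x
    unfolding K_def prod.case
    by (rule homotopy_orbit_map_class[OF X Y UX U(2)]) (use that HY He in auto)
  have q: "quotient_map ?PU ?W ?qX"
    using X U by (rule quotient_map_orbit_image)
  have "quotient_map (prod_topology unit_interval ?PU) (prod_topology unit_interval ?W) (\<lambda>(t, z). (t, ?qX z))"
    by (rule quotient_map_prod_right[OF _ _ q])
      (auto intro: compact_imp_locally_compact_space simp: compact_space_subtopology Hausdorff_space_subtopology)
  moreover have "continuous_map (prod_topology unit_interval ?PU) (homotopy_orbit_space \<Gamma> P \<rho> Y \<psi>)
      (K \<circ> (\<lambda>(t, z). (t, ?qX z)))"
  proof (rule continuous_map_eq)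
    let ?g = "\<lambda>z. (fst (snd z), H (fst z, snd (snd z)))"
    have 1: "continuous_map (prod_topology unit_interval ?PU) P (\<lambda>z. fst (snd z))"
      using continuous_map_compose[OF continuous_map_snd continuous_map_fst] by (simp add: o_def)
    have 2: "continuous_map (prod_topology unit_interval ?PU) (subtopology X U) (\<lambda>z. snd (snd z))"
      using continuous_map_compose[OF continuous_map_snd continuous_map_snd] by (simp add: o_def)
    have 3: "continuous_map (prod_topology unit_interval ?PU) Y (H \<circ> (\<lambda>z. (fst z, snd (snd z))))"
      by (rule continuous_map_compose[OF _ Hc])
        (use 2 in \<open>simp add: continuous_map_pairwise o_def continuous_map_fst\<close>)
    have "continuous_map (prod_topology unit_interval ?PU) (prod_topology P Y) ?g"
      using 1 3 by (simp add: continuous_map_pairwise o_def)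
    then show "continuous_map (prod_topology unit_interval ?PU) (homotopy_orbit_space \<Gamma> P \<rho> Y \<psi>) (?qY \<circ> ?g)"
      by (rule continuous_map_compose) (rule quotient_imp_continuous_map[OF quotient_map_orbit_class])
    show "(?qY \<circ> ?g) z = (K \<circ> (\<lambda>(t, z). (t, ?qX z))) z"
      if "z \<in> topspace (prod_topology unit_interval ?PU)" for z
      using that by (auto simp: K)
  qed
  ultimately have "continuous_map (prod_topology unit_interval ?W) (homotopy_orbit_space \<Gamma> P \<rho> Y \<psi>) K"
    by (rule continuous_compose_quotient_map)
  moreover have "K (0, C) = homotopy_orbit_map \<Gamma> P \<rho> Y \<psi> f C \<and> K (1, C) = homotopy_orbit_map \<Gamma> P \<rho> Y \<psi> f' C"
    if "C \<in> topspace ?W" for C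
  proof -
    obtain e x where C: "C = ?qX (e, x)" "e \<in> topspace P" "x \<in> U"
      using \<open>C \<in> topspace ?W\<close> by (auto simp: orbit_image_def)
    have "homotopy_orbit_map \<Gamma> P \<rho> Y \<psi> (\<lambda>x. H (t, x)) C = homotopy_orbit_map \<Gamma> P \<rho> Y \<psi> h C"
      if "\<And>x. x \<in> U \<Longrightarrow> H (t, x) = h x" for t h
    proof -
      have "x' \<in> U" if "(e', x') \<in> C" for e' x'
        using that C U(2) by (auto simp: homotopy_orbit_rel_iff)
      then show ?thesis
        using that unfolding homotopy_orbit_map_def by (intro SUP_cong) auto
    qed
    from this[of 0 f] this[of 1 f'] show ?thesis
      using H01 UX unfolding K_def by (simp add: subset_iff)
  qed
  ultimately show ?thesis
    by (subst homotopic_with) (rule refl, intro exI[of _ K], simp)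
qed

lemma continuous_homotopy_orbit_map:
  assumes X: "G_space \<Gamma> T X \<phi>" and Y: "G_space \<Gamma> T Y \<psi>"
    and U: "openin X U" "\<And>g. g \<in> carrier \<Gamma> \<Longrightarrow> \<phi> g ` U \<subseteq> U"
    and f: "G_map \<Gamma> (subtopology X U) \<phi> Y \<psi> f"
  shows "continuous_map (subtopology (homotopy_orbit_space \<Gamma> P \<rho> X \<phi>) (orbit_image X \<phi> U))
     (homotopy_orbit_space \<Gamma> P \<rho> Y \<psi>) (homotopy_orbit_map \<Gamma> P \<rho> Y \<psi> f)"
proof -
  have "continuous_map (prod_topology unit_interval (subtopology X U)) Y (f \<circ> snd)"
    by (rule continuous_map_compose[OF continuous_map_snd]) (use f in \<open>simp add: G_map_def\<close>)
  then have "G_homotopic \<Gamma> (subtopology X U) \<phi> Y \<psi> f f"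
    using f unfolding G_homotopic_def G_map_def
    by (intro exI[of _ "f \<circ> snd"]) (auto simp: cylinder_action_def)
  from homotopic_with_imp_continuous_maps[OF homotopic_homotopy_orbit_map[OF X Y U this]]
  show ?thesis by simp
qed

text \<open>On \<open>q (P \<times> U)\<close> the identity is homotopic to the map induced by \<open>i \<circ> r\<close>, which factors through
  the homotopy orbit space of \<open>Z\<close>, where the pullback of \<open>c\<close> is a coboundary. The intermediate map
  \<open>f\<close> stands for a homotopy section followed by the map that it is a section of.\<close>

lemma restriction_to_orbit_image_bounds:
  assumes Y: "G_space \<Gamma> T Y \<psi>" and Z: "G_space \<Gamma> T Z \<zeta>"
    and i: "G_map \<Gamma> Z \<zeta> Y \<psi> i"
    and U: "openin Y U" "\<And>g. g \<in> carrier \<Gamma> \<Longrightarrow> \<psi> g ` U \<subseteq> U"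
    and r: "G_map \<Gamma> (subtopology Y U) \<psi> Z \<zeta> r"
    and hom: "G_homotopic \<Gamma> (subtopology Y U) \<psi> Y \<psi> f id"
      "G_homotopic \<Gamma> (subtopology Y U) \<psi> Y \<psi> f (i \<circ> r)"
    and c: "c \<in> singular_cocycles (homotopy_orbit_space \<Gamma> P \<rho> Y \<psi>)"
    and ic: "cochain_pullback (homotopy_orbit_space \<Gamma> P \<rho> Z \<zeta>) (homotopy_orbit_map \<Gamma> P \<rho> Y \<psi> i) c
       \<in> coboundaries (homotopy_orbit_space \<Gamma> P \<rho> Z \<zeta>)"
  shows "cochain_pullback (subtopology (homotopy_orbit_space \<Gamma> P \<rho> Y \<psi>) (orbit_image Y \<psi> U)) (\<lambda>x. x) c
     \<in> coboundaries (subtopology (homotopy_orbit_space \<Gamma> P \<rho> Y \<psi>) (orbit_image Y \<psi> U))"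
proof -
  let ?W = "subtopology (homotopy_orbit_space \<Gamma> P \<rho> Y \<psi>) (orbit_image Y \<psi> U)"
  let ?m = "homotopy_orbit_map \<Gamma> P \<rho> Y \<psi>" and ?r = "homotopy_orbit_map \<Gamma> P \<rho> Z \<zeta> r"
  have UY: "U \<subseteq> topspace Y" using U(1) by (rule openin_subset)
  have cls: "\<exists>e x. C = orbit_class \<Gamma> P \<rho> Y \<psi> (e, x) \<and> e \<in> topspace P \<and> x \<in> U" if "C \<in> topspace ?W" for C
    using that by (auto simp: orbit_image_def)
  have rU: "r x \<in> topspace Z" "g \<in> carrier \<Gamma> \<Longrightarrow> r (\<psi> g x) = \<zeta> g (r x)" if "x \<in> U" for g x
    using r that UY by (auto simp: G_map_def continuous_map_def)
  have iZ: "i x \<in> topspace Y" "g \<in> carrier \<Gamma> \<Longrightarrow> i (\<zeta> g x) = \<psi> g (i x)" if "x \<in> topspace Z" for g x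
    using i that by (auto simp: G_map_def continuous_map_def)
  have invZ: "\<zeta> g ` topspace Z \<subseteq> topspace Z" if "g \<in> carrier \<Gamma>" for g
    using Z that top_group by (auto simp: G_space_def topological_group_def continuous_map_def Pi_iff)
  have id: "?m id C = C" if C: "C \<in> topspace ?W" for C
  proof -
    obtain e x where "C = orbit_class \<Gamma> P \<rho> Y \<psi> (e, x)" "e \<in> topspace P" "x \<in> U" using cls[OF C] by blast
    then show ?thesis
      using homotopy_orbit_map_class[OF Y Y UY U(2), of id e x] UY by auto
  qed
  have comp: "?m (i \<circ> r) C = (?m i \<circ> ?r) C" if C: "C \<in> topspace ?W" for C
  proof -
    obtain e x where ex: "C = orbit_class \<Gamma> P \<rho> Y \<psi> (e, x)" "e \<in> topspace P" "x \<in> U" using cls[OF C] by blast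
    have "?m (i \<circ> r) C = orbit_class \<Gamma> P \<rho> Y \<psi> (e, i (r x))"
      unfolding ex(1) using homotopy_orbit_map_class[OF Y Y UY U(2), of "i \<circ> r" e x] rU iZ ex by auto
    moreover have "?r C = orbit_class \<Gamma> P \<rho> Z \<zeta> (e, r x)"
      unfolding ex(1) using homotopy_orbit_map_class[OF Y Z UY U(2), of r e x] rU ex by auto
    moreover have "?m i (orbit_class \<Gamma> P \<rho> Z \<zeta> (e, r x)) = orbit_class \<Gamma> P \<rho> Y \<psi> (e, i (r x))"
      using homotopy_orbit_map_class[OF Z Y subset_refl invZ, of i e "r x"] rU iZ ex by auto
    ultimately show ?thesis by simp
  qed
  have "homotopic_with (\<lambda>h. True) ?W (homotopy_orbit_space \<Gamma> P \<rho> Y \<psi>) (?m (i \<circ> r)) (?m id)"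
    by (rule homotopic_with_trans[OF homotopic_with_symD[OF homotopic_homotopy_orbit_map[OF Y Y U hom(2)]]
          homotopic_homotopy_orbit_map[OF Y Y U hom(1)]])
  then have 1: "(\<lambda>n \<sigma>. cochain_pullback ?W (?m id) c n \<sigma> - cochain_pullback ?W (?m (i \<circ> r)) c n \<sigma>) \<in> coboundaries ?W"
    using c by (rule cochain_pullback_homotopic)
  have rc: "continuous_map ?W (homotopy_orbit_space \<Gamma> P \<rho> Z \<zeta>) ?r"
    by (rule continuous_homotopy_orbit_map[OF Y Z U r])
  have "cochain_pullback ?W (?m (i \<circ> r)) c = cochain_pullback ?W ?r (cochain_pullback (homotopy_orbit_space \<Gamma> P \<rho> Z \<zeta>) (?m i) c)"
    unfolding cochain_pullback_compose[OF rc] by (rule cochain_pullback_cong) (rule comp)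
  then have "cochain_pullback ?W (?m (i \<circ> r)) c \<in> coboundaries ?W"
    using cochain_pullback_coboundary[OF ic rc] by simp
  from coboundaries_add[OF 1 this] have "cochain_pullback ?W (?m id) c \<in> coboundaries ?W"
    by simp
  moreover have "cochain_pullback ?W (?m id) c = cochain_pullback ?W (\<lambda>x. x) c"
    by (rule cochain_pullback_cong) (rule id)
  ultimately show ?thesis by simp
qed

end

section \<open>Spaces of pairs over orbits\<close>

lemma topological_group_DirProd:
  assumes "topological_group G T" "topological_group H S"
  shows "topological_group (G \<times>\<times> H) (prod_topology T S)"
proof -
  have G: "group G" "topspace T = carrier G" "Hausdorff_space T"
      "continuous_map (prod_topology T T) T (\<lambda>(g, h). g \<otimes>\<^bsub>G\<^esub> h)" "continuous_map T T (\<lambda>g. inv\<^bsub>G\<^esub> g)"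
    and H: "group H" "topspace S = carrier H" "Hausdorff_space S"
      "continuous_map (prod_topology S S) S (\<lambda>(g, h). g \<otimes>\<^bsub>H\<^esub> h)" "continuous_map S S (\<lambda>g. inv\<^bsub>H\<^esub> g)"
    using assms by (auto simp: topological_group_def)
  let ?P = "prod_topology (prod_topology T S) (prod_topology T S)"
  have p: "continuous_map ?P T (\<lambda>z. fst (fst z))" "continuous_map ?P S (\<lambda>z. snd (fst z))"
    "continuous_map ?P T (\<lambda>z. fst (snd z))" "continuous_map ?P S (\<lambda>z. snd (snd z))"
    by (rule continuous_map_compose[OF continuous_map_fst continuous_map_fst, unfolded o_def]
        continuous_map_compose[OF continuous_map_fst continuous_map_snd, unfolded o_def]
        continuous_map_compose[OF continuous_map_snd continuous_map_fst, unfolded o_def]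
        continuous_map_compose[OF continuous_map_snd continuous_map_snd, unfolded o_def])+
  have 1: "continuous_map ?P T ((\<lambda>(g, h). g \<otimes>\<^bsub>G\<^esub> h) \<circ> (\<lambda>z. (fst (fst z), fst (snd z))))"
    by (rule continuous_map_compose[OF _ G(4)]) (use p in \<open>simp add: continuous_map_pairwise o_def\<close>)
  have 2: "continuous_map ?P S ((\<lambda>(g, h). g \<otimes>\<^bsub>H\<^esub> h) \<circ> (\<lambda>z. (snd (fst z), snd (snd z))))"
    by (rule continuous_map_compose[OF _ H(4)]) (use p in \<open>simp add: continuous_map_pairwise o_def\<close>)
  have m: "continuous_map ?P (prod_topology T S) (\<lambda>(x, y). x \<otimes>\<^bsub>G \<times>\<times> H\<^esub> y)"
    using 1 2 by (simp add: continuous_map_pairwise o_def case_prod_beta mult_DirProd')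
  have "continuous_map (prod_topology T S) (prod_topology T S) (\<lambda>z. (inv\<^bsub>G\<^esub> (fst z), inv\<^bsub>H\<^esub> (snd z)))"
    unfolding continuous_map_pairwise o_def fst_conv snd_conv
    by (intro conjI continuous_map_compose[OF continuous_map_fst G(5), unfolded o_def]
        continuous_map_compose[OF continuous_map_snd H(5), unfolded o_def])
  then have i: "continuous_map (prod_topology T S) (prod_topology T S) (\<lambda>z. inv\<^bsub>G \<times>\<times> H\<^esub> z)"
    by (rule continuous_map_eq) (use G H in auto)
  show ?thesis
    using G H m i by (simp add: topological_group_def DirProd_group Hausdorff_space_prod_topology)
qed

lemma G_space_product:
  assumes "G_space G T X \<phi>" "G_space H S Y \<psi>"
  shows "G_space (G \<times>\<times> H) (prod_topology T S) (prod_topology X Y) (product_action \<phi> \<psi>)"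
proof -
  have X: "Hausdorff_space X" "continuous_map (prod_topology T X) X (\<lambda>(g, x). \<phi> g x)"
    and Y: "Hausdorff_space Y" "continuous_map (prod_topology S Y) Y (\<lambda>(g, y). \<psi> g y)"
    using assms by (auto simp: G_space_def)
  let ?P = "prod_topology (prod_topology T S) (prod_topology X Y)"
  have p: "continuous_map ?P T (\<lambda>z. fst (fst z))" "continuous_map ?P S (\<lambda>z. snd (fst z))"
    "continuous_map ?P X (\<lambda>z. fst (snd z))" "continuous_map ?P Y (\<lambda>z. snd (snd z))"
    by (rule continuous_map_compose[OF continuous_map_fst continuous_map_fst, unfolded o_def]
        continuous_map_compose[OF continuous_map_fst continuous_map_snd, unfolded o_def]
        continuous_map_compose[OF continuous_map_snd continuous_map_fst, unfolded o_def]
        continuous_map_compose[OF continuous_map_snd continuous_map_snd, unfolded o_def])+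
  have 1: "continuous_map ?P X ((\<lambda>(g, x). \<phi> g x) \<circ> (\<lambda>z. (fst (fst z), fst (snd z))))"
    by (rule continuous_map_compose[OF _ X(2)]) (use p in \<open>simp add: continuous_map_pairwise o_def\<close>)
  have 2: "continuous_map ?P Y ((\<lambda>(g, y). \<psi> g y) \<circ> (\<lambda>z. (snd (fst z), snd (snd z))))"
    by (rule continuous_map_compose[OF _ Y(2)]) (use p in \<open>simp add: continuous_map_pairwise o_def\<close>)
  have "continuous_map ?P (prod_topology X Y) (\<lambda>(g, z). product_action \<phi> \<psi> g z)"
    using 1 2 by (simp add: continuous_map_pairwise o_def case_prod_beta product_action_def)
  then show ?thesis
    using assms by (auto simp: G_space_def Hausdorff_space_prod_topology product_action_def)
qed

lemma G_space_subtopology: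
  assumes G: "topological_group G T" and X: "G_space G T X \<phi>"
    and A: "\<And>g x. g \<in> carrier G \<Longrightarrow> x \<in> topspace X \<Longrightarrow> x \<in> A \<Longrightarrow> \<phi> g x \<in> A"
  shows "G_space G T (subtopology X A) \<phi>"
proof -
  have "continuous_map (prod_topology T (subtopology X A)) X (\<lambda>(g, x). \<phi> g x)"
    using X by (simp add: G_space_def prod_topology_subtopology continuous_map_from_subtopology)
  then have "continuous_map (prod_topology T (subtopology X A)) (subtopology X A) (\<lambda>(g, x). \<phi> g x)"
    using A G by (auto simp: continuous_map_in_subtopology topological_group_def)
  then show ?thesis
    using X by (auto simp: G_space_def Hausdorff_space_subtopology)
qed

lemma orbit_action:
  assumes G: "topological_group G T" and X: "G_space G T X \<phi>" and g: "g \<in> carrier G" and x: "x \<in> topspace X"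
  shows "orbit G \<phi> (\<phi> g x) = orbit G \<phi> x"
proof -
  interpret group G using G by (simp add: topological_group_def)
  have act: "\<phi> (h \<otimes>\<^bsub>G\<^esub> k) x = \<phi> h (\<phi> k x)" if "h \<in> carrier G" "k \<in> carrier G" for h k
    using X x that by (simp add: G_space_def)
  have "\<phi> h (\<phi> g x) \<in> orbit G \<phi> x" if "h \<in> carrier G" for h
    unfolding orbit_def using act[OF that g] that g by (auto intro!: exI[of _ "h \<otimes>\<^bsub>G\<^esub> g"])
  moreover have "\<phi> h x \<in> orbit G \<phi> (\<phi> g x)" if "h \<in> carrier G" for h
    unfolding orbit_def using act[of "h \<otimes>\<^bsub>G\<^esub> inv\<^bsub>G\<^esub> g" g] that g
    by (auto simp: m_assoc intro!: exI[of _ "h \<otimes>\<^bsub>G\<^esub> inv\<^bsub>G\<^esub> g"])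
  ultimately show ?thesis by (auto simp: orbit_def)
qed

lemma orbit_eq_image:
  assumes G: "topological_group G T" and X: "G_space G T X \<phi>" and Y: "G_space G T Y \<psi>"
    and f: "G_map G X \<phi> Y \<psi> f"
    and x: "x \<in> topspace X" and y: "y \<in> topspace X" and eq: "orbit G \<phi> x = orbit G \<phi> y"
  shows "orbit G \<psi> (f x) = orbit G \<psi> (f y)"
proof -
  interpret group G using G by (simp add: topological_group_def)
  have "x \<in> orbit G \<phi> x"
    unfolding orbit_def using X x by (auto simp: G_space_def intro!: exI[of _ "\<one>\<^bsub>G\<^esub>"])
  then obtain g where "g \<in> carrier G" "x = \<phi> g y"
    unfolding eq by (auto simp: orbit_def)
  moreover have "f y \<in> topspace Y"
    using f y by (auto simp: G_map_def continuous_map_def)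
  ultimately show ?thesis
    using orbit_action[OF G Y] f y by (simp add: G_map_def)
qed

lemma G_space_pairs_over_orbits:
  assumes G: "topological_group G T" and E: "G_space G T E \<phi>"
  shows "G_space (G \<times>\<times> G) (prod_topology T T) (pairs_over_orbits G E \<phi>) (product_action \<phi> \<phi>)"
  unfolding pairs_over_orbits_def
  by (rule G_space_subtopology[OF topological_group_DirProd[OF G G] G_space_product[OF E E]])
    (auto simp: product_action_def orbit_action[OF G E])

lemma G_space_pairs_over_base_orbits:
  assumes G: "topological_group G T" and E: "G_space G T E \<phi>" and B: "G_space G T B \<psi>"
    and p: "G_map G E \<phi> B \<psi> p"
  shows "G_space (G \<times>\<times> G) (prod_topology T T) (pairs_over_base_orbits G E \<psi> p) (product_action \<phi> \<phi>)"
proof -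
  have "orbit G \<psi> (p (\<phi> g e)) = orbit G \<psi> (p e)" if "g \<in> carrier G" "e \<in> topspace E" for g e
    using p that orbit_action[OF G B, of g "p e"] by (auto simp: G_map_def continuous_map_def)
  then show ?thesis
    unfolding pairs_over_base_orbits_def
    by (intro G_space_subtopology[OF topological_group_DirProd[OF G G] G_space_product[OF E E]])
      (auto simp: product_action_def)
qed

lemma G_map_pairs_inclusion:
  assumes G: "topological_group G T" and E: "G_space G T E \<phi>" and B: "G_space G T B \<psi>"
    and p: "G_map G E \<phi> B \<psi> p"
  shows "G_map \<Gamma> (pairs_over_orbits G E \<phi>) \<alpha> (pairs_over_base_orbits G E \<psi> p) \<alpha> (\<lambda>e. e)"
  using orbit_eq_image[OF G E B p]
  by (auto simp: G_map_def pairs_over_orbits_def pairs_over_base_orbits_def continuous_map_in_subtopology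
      continuous_map_from_subtopology)

section \<open>Midpoints of path pairs and the cohomological bound\<close>

text \<open>The end of the first path and the start of the second: the two points that lie in one orbit.\<close>

definition midpoint_map :: "(real \<Rightarrow> 'e) \<times> (real \<Rightarrow> 'e) \<Rightarrow> 'e \<times> 'e" where
  "midpoint_map = (\<lambda>(\<gamma>, \<delta>). (\<gamma> 1, \<delta> 0))"

lemma continuous_map_path_pair_eval:
  assumes a: "continuous_map X unit_interval a" and b: "continuous_map X unit_interval b"
    and s: "continuous_map X (fibrewise_path_pairs G E \<phi> B p) s"
  shows "continuous_map X (prod_topology E E) (\<lambda>x. (fst (s x) (a x), snd (s x) (b x)))"
proof -
  let ?C = "compact_open unit_interval E"
  have "continuous_map X (prod_topology ?C ?C) s"
    using s unfolding fibrewise_path_pairs_def fibrewise_paths_def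
    by (simp add: prod_topology_subtopology subtopology_subtopology continuous_map_in_subtopology)
  then have s12: "continuous_map X ?C (\<lambda>x. fst (s x))" "continuous_map X ?C (\<lambda>x. snd (s x))"
    by (auto simp: continuous_map_pairwise o_def)
  have "continuous_map X E ((\<lambda>(t, w). w t) \<circ> (\<lambda>x. (a x, fst (s x))))"
    by (rule continuous_map_compose[OF _ continuous_map_path_eval])
      (use a s12 in \<open>simp add: continuous_map_pairwise o_def\<close>)
  moreover have "continuous_map X E ((\<lambda>(t, w). w t) \<circ> (\<lambda>x. (b x, snd (s x))))"
    by (rule continuous_map_compose[OF _ continuous_map_path_eval])
      (use b s12 in \<open>simp add: continuous_map_pairwise o_def\<close>)
  ultimately show ?thesis
    by (simp add: continuous_map_pairwise o_def)
qed

lemma path_pairD: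
  assumes "(\<gamma>, \<delta>) \<in> topspace (fibrewise_path_pairs G E \<phi> B p)"
  shows "t \<in> {0..1} \<Longrightarrow> \<gamma> t \<in> topspace E" "t \<in> {0..1} \<Longrightarrow> \<delta> t \<in> topspace E"
    "t \<in> {0..1} \<Longrightarrow> p (\<gamma> t) = p (\<gamma> 1)" "t \<in> {0..1} \<Longrightarrow> p (\<delta> t) = p (\<delta> 0)"
    "orbit G \<phi> (\<gamma> 1) = orbit G \<phi> (\<delta> 0)"
  using assms
  by (auto simp: fibrewise_path_pairs_def fibrewise_paths_def topspace_compact_open continuous_map_def Pi_iff)

lemma G_map_midpoint_map:
  "G_map (G \<times>\<times> G) (fibrewise_path_pairs G E \<phi> B p) (product_action (path_action \<phi>) (path_action \<phi>))
     (pairs_over_orbits G E \<phi>) (product_action \<phi> \<phi>) midpoint_map"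
proof -
  let ?PP = "fibrewise_path_pairs G E \<phi> B p"
  have "continuous_map ?PP (prod_topology E E) (\<lambda>x. (fst (id x) 1, snd (id x) 0))"
    by (rule continuous_map_path_pair_eval[where G = G and \<phi> = \<phi> and B = B and p = p]) auto
  then have "continuous_map ?PP (prod_topology E E) midpoint_map"
    by (rule continuous_map_eq) (auto simp: midpoint_map_def)
  then have "continuous_map ?PP (pairs_over_orbits G E \<phi>) midpoint_map"
    using path_pairD(5)[of _ _ G E \<phi> B p]
    by (auto simp: pairs_over_orbits_def continuous_map_in_subtopology midpoint_map_def)
  then show ?thesis
    by (auto simp: G_map_def midpoint_map_def product_action_def path_action_def)
qed

text \<open>At time \<open>t\<close> the pair is \<open>(\<gamma>(t), \<delta>(1 - t))\<close>. The projections of its components to \<open>B\<close> do not depend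
  on \<open>t\<close>, and at \<open>t = 1\<close> they lie in one orbit.\<close>

lemma G_homotopic_endpoint_midpoint:
  fixes E :: "'e topology"
  assumes G: "topological_group G T" and E: "G_space G T E \<phi>" and B: "G_space G T B \<psi>"
    and p: "G_map G E \<phi> B \<psi> p"
  shows "G_homotopic (G \<times>\<times> G)
     (fibrewise_path_pairs G E \<phi> B p) (product_action (path_action \<phi>) (path_action \<phi>))
     (pairs_over_base_orbits G E \<psi> p) (product_action \<phi> \<phi>) endpoint_map midpoint_map"
proof -
  let ?PP = "fibrewise_path_pairs G E \<phi> B p"
  let ?I = "prod_topology unit_interval ?PP"
  define H where "H = (\<lambda>z :: real \<times> (real \<Rightarrow> 'e) \<times> (real \<Rightarrow> 'e). (fst (snd z) (fst z), snd (snd z) (1 - fst z)))"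
  have "continuous_map ?I unit_interval (\<lambda>z. 1 - fst z)"
    by (auto simp: continuous_map_in_subtopology
        intro!: continuous_intros continuous_map_into_fulltopology[OF continuous_map_fst])
  then have "continuous_map ?I (prod_topology E E) H"
    unfolding H_def by (rule continuous_map_path_pair_eval[OF continuous_map_fst _ continuous_map_snd])
  moreover have "orbit G \<psi> (p (\<gamma> t)) = orbit G \<psi> (p (\<delta> (1 - t)))"
    if "(\<gamma>, \<delta>) \<in> topspace ?PP" "0 \<le> t" "t \<le> 1" for \<gamma> \<delta> t
    using orbit_eq_image[OF G E B p path_pairD(1)[OF that(1)] path_pairD(2)[OF that(1)] path_pairD(5)[OF that(1)]]
      path_pairD(3)[OF that(1), of t] path_pairD(4)[OF that(1), of "1 - t"] that by simp
  ultimately have "continuous_map ?I (pairs_over_base_orbits G E \<psi> p) H"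
    by (auto simp: pairs_over_base_orbits_def continuous_map_in_subtopology H_def)
  then show ?thesis
    unfolding G_homotopic_def G_map_def
    by (intro exI[of _ H])
      (auto simp: H_def cylinder_action_def product_action_def path_action_def endpoint_map_def midpoint_map_def)
qed

lemma G_map_compose:
  assumes s: "G_map G X \<phi> Y \<psi> s" and f: "G_map G Y \<psi> Z \<zeta> f"
  shows "G_map G X \<phi> Z \<zeta> (f \<circ> s)"
  using assms continuous_map_compose[of X Y s Z f]
  by (auto simp: G_map_def continuous_map_def Pi_iff)

lemma G_homotopic_compose:
  assumes s: "G_map G X \<phi> Y \<psi> s" and f: "G_homotopic G Y \<psi> Z \<zeta> f f'"
  shows "G_homotopic G X \<phi> Z \<zeta> (f \<circ> s) (f' \<circ> s)"
proof -
  obtain H where H: "G_map G (prod_topology unit_interval Y) (cylinder_action \<psi>) Z \<zeta> H"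
    "\<forall>x \<in> topspace Y. H (0, x) = f x \<and> H (1, x) = f' x"
    using f by (auto simp: G_homotopic_def)
  have sY: "s x \<in> topspace Y" if "x \<in> topspace X" for x
    using s that by (auto simp: G_map_def continuous_map_def)
  have "continuous_map (prod_topology unit_interval X) (prod_topology unit_interval Y) (map_prod id s)"
    using s by (intro continuous_map_cylinder) (simp add: G_map_def)
  then have "G_map G (prod_topology unit_interval X) (cylinder_action \<phi>)
      (prod_topology unit_interval Y) (cylinder_action \<psi>) (map_prod id s)"
    using s by (auto simp: G_map_def cylinder_action_def)
  from G_map_compose[OF this H(1)] show ?thesis
    unfolding G_homotopic_def using H(2) sY by (intro exI[of _ "H \<circ> map_prod id s"]) auto
qed

lemma secat_le_cover:
  assumes "secat G X \<phi> Y \<psi> q \<le> enat k"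
  obtains m U where "1 \<le> m" "m \<le> k" "topspace Y = (\<Union>i\<in>{1..m}. U i)"
    "\<And>i. i \<in> {1..m} \<Longrightarrow> openin Y (U i)"
    "\<And>i g. i \<in> {1..m} \<Longrightarrow> g \<in> carrier G \<Longrightarrow> \<psi> g ` U i \<subseteq> U i"
    "\<And>i. i \<in> {1..m} \<Longrightarrow> \<exists>s. G_map G (subtopology Y (U i)) \<psi> X \<phi> s \<and>
       G_homotopic G (subtopology Y (U i)) \<psi> Y \<psi> (q \<circ> s) id"
proof -
  have "secat G X \<phi> Y \<psi> q < enat (Suc k)"
    using assms by (rule le_less_trans) simp
  then obtain m U where "m < Suc k" "1 \<le> m" "topspace Y = (\<Union>i\<in>{1..m}. U i)"
    "\<forall>i\<in>{1..m}. openin Y (U i) \<and> (\<forall>g \<in> carrier G. \<psi> g ` U i \<subseteq> U i) \<and>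
             (\<exists>s. G_map G (subtopology Y (U i)) \<psi> X \<phi> s \<and>
                  G_homotopic G (subtopology Y (U i)) \<psi> Y \<psi> (q \<circ> s) id)"
    unfolding secat_def Inf_less_iff by auto
  then show ?thesis by (intro that[of m U]) auto
qed

theorem theorem4p15:
  fixes G :: "('g, 'm) monoid_scheme" and T :: "'g topology"
    and E :: "'e topology" and \<phi> :: "'g \<Rightarrow> 'e \<Rightarrow> 'e"
    and B :: "'b topology" and \<psi> :: "'g \<Rightarrow> 'b \<Rightarrow> 'b"
    and p :: "'e \<Rightarrow> 'b"
    and EG2 :: "'z topology" and \<rho> :: "'z \<Rightarrow> 'g \<times> 'g \<Rightarrow> 'z"
    and BG2 :: "'w topology" and \<pi> :: "'z \<Rightarrow> 'w"
    and x0 :: "('z \<times> 'e \<times> 'e) set"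
    and k :: nat
    and u :: "nat \<Rightarrow> (('z \<times> 'e \<times> 'e) set, 'r::comm_ring_1) cochain set"
  assumes "topological_group G T"
    and "G_fibration G T E \<phi> B \<psi> p"
    and "universal_principal_bundle (G \<times>\<times> G) (prod_topology T T) EG2 \<rho> BG2 \<pi>"
    and "x0 \<in> topspace (homotopy_orbit_space (G \<times>\<times> G) EG2 \<rho>
                 (pairs_over_base_orbits G E \<psi> p) (product_action \<phi> \<phi>))"
    and "\<forall>j \<in> {1..k}. u j \<in> reduced_borel_cohomology (G \<times>\<times> G) EG2 \<rho>
                 (pairs_over_base_orbits G E \<psi> p) (product_action \<phi> \<phi>) x0"
    and "\<forall>j \<in> {1..k}.
           borel_cohomology_map (G \<times>\<times> G) EG2 \<rho>
             (pairs_over_orbits G E \<phi>) (product_action \<phi> \<phi>)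
             (pairs_over_base_orbits G E \<psi> p) (product_action \<phi> \<phi>) (\<lambda>e. e) (u j)
           = \<zero>\<^bsub>borel_cohomology (G \<times>\<times> G) EG2 \<rho> (pairs_over_orbits G E \<phi>) (product_action \<phi> \<phi>)\<^esub>"
    and "let H = borel_cohomology (G \<times>\<times> G) EG2 \<rho>
                   (pairs_over_base_orbits G E \<psi> p) (product_action \<phi> \<phi>)
         in foldr (\<otimes>\<^bsub>H\<^esub>) (map u [1..<Suc k]) \<one>\<^bsub>H\<^esub> \<noteq> \<zero>\<^bsub>H\<^esub>"
  shows "invariant_param_TC G E \<phi> B \<psi> p > enat k"
proof (rule ccontr)
  let ?\<Gamma> = "G \<times>\<times> G" and ?\<alpha> = "product_action \<phi> \<phi>"
  let ?Y = "pairs_over_base_orbits G E \<psi> p" and ?Z = "pairs_over_orbits G E \<phi>"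
  let ?PP = "fibrewise_path_pairs G E \<phi> B p" and ?\<beta> = "product_action (path_action \<phi>) (path_action \<phi>)"
  let ?Yh = "homotopy_orbit_space ?\<Gamma> EG2 \<rho> ?Y ?\<alpha>" and ?Zh = "homotopy_orbit_space ?\<Gamma> EG2 \<rho> ?Z ?\<alpha>"
  have E: "G_space G T E \<phi>" and B: "G_space G T B \<psi>" and p: "G_map G E \<phi> B \<psi> p"
    using assms(2) by (auto simp: G_fibration_def)
  have Y: "G_space ?\<Gamma> (prod_topology T T) ?Y ?\<alpha>"
    using assms(1) E B p by (rule G_space_pairs_over_base_orbits)
  have Z: "G_space ?\<Gamma> (prod_topology T T) ?Z ?\<alpha>"
    using assms(1) E by (rule G_space_pairs_over_orbits)
  interpret homotopy_orbits ?\<Gamma> "prod_topology T T" EG2 \<rho> BG2 \<pi>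
    using assms(1,3)
    by (simp add: homotopy_orbits_def topological_group_DirProd universal_principal_bundle_def)

  assume "\<not> enat k < invariant_param_TC G E \<phi> B \<psi> p"
  then have "secat ?\<Gamma> ?PP ?\<beta> ?Y ?\<alpha> endpoint_map \<le> enat k"
    by (simp add: invariant_param_TC_def)
  then obtain m U where m: "1 \<le> m" "m \<le> k" and cover: "topspace ?Y = (\<Union>i\<in>{1..m}. U i)"
    and U: "\<And>i. i \<in> {1..m} \<Longrightarrow> openin ?Y (U i)"
      "\<And>i g. i \<in> {1..m} \<Longrightarrow> g \<in> carrier ?\<Gamma> \<Longrightarrow> ?\<alpha> g ` U i \<subseteq> U i"
    and sec: "\<And>i. i \<in> {1..m} \<Longrightarrow> \<exists>s. G_map ?\<Gamma> (subtopology ?Y (U i)) ?\<alpha> ?PP ?\<beta> s \<and>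
       G_homotopic ?\<Gamma> (subtopology ?Y (U i)) ?\<alpha> ?Y ?\<alpha> (endpoint_map \<circ> s) id"
    by (rule secat_le_cover) (rule that)

  have "\<exists>c. c \<in> singular_cocycles ?Yh \<and> u j = cohomology_class ?Yh c" if "j \<in> {1..k}" for j
  proof -
    have "u j \<in> cohomology_class ?Yh ` singular_cocycles ?Yh"
      using assms(5) that
      by (simp add: reduced_borel_cohomology_def reduced_cohomology_def carrier_singular_cohomology)
    then show ?thesis by (rule imageE) (intro exI conjI)
  qed
  then have "\<forall>j\<in>{1..k}. \<exists>c. c \<in> singular_cocycles ?Yh \<and> u j = cohomology_class ?Yh c"
    by (rule ballI)
  from bchoice[OF this] obtain c where
    c: "\<And>j. j \<in> {1..k} \<Longrightarrow> c j \<in> singular_cocycles ?Yh"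
      "\<And>j. j \<in> {1..k} \<Longrightarrow> u j = cohomology_class ?Yh (c j)"
    by blast
  have ic: "cochain_pullback ?Zh (homotopy_orbit_map ?\<Gamma> EG2 \<rho> ?Y ?\<alpha> (\<lambda>e. e)) (c j) \<in> coboundaries ?Zh"
    if "j \<in> {1..k}" for j
    by (rule cohomology_map_zeroD[OF c(2)[OF that]])
      (use assms(6) that in \<open>simp add: borel_cohomology_map_def borel_cohomology_def\<close>)

  have res: "cochain_pullback (subtopology ?Yh (orbit_image ?Y ?\<alpha> (U i))) (\<lambda>x. x) (c j)
      \<in> coboundaries (subtopology ?Yh (orbit_image ?Y ?\<alpha> (U i)))"
    if i: "i \<in> {1..m}" and j: "j \<in> {1..k}" for i j
  proof -
    obtain s where s: "G_map ?\<Gamma> (subtopology ?Y (U i)) ?\<alpha> ?PP ?\<beta> s"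
      "G_homotopic ?\<Gamma> (subtopology ?Y (U i)) ?\<alpha> ?Y ?\<alpha> (endpoint_map \<circ> s) id"
      using sec[OF i] by blast
    have "G_homotopic ?\<Gamma> (subtopology ?Y (U i)) ?\<alpha> ?Y ?\<alpha> (endpoint_map \<circ> s) (midpoint_map \<circ> s)"
      by (rule G_homotopic_compose[OF s(1) G_homotopic_endpoint_midpoint[OF assms(1) E B p]])
    then have mid: "G_homotopic ?\<Gamma> (subtopology ?Y (U i)) ?\<alpha> ?Y ?\<alpha> (endpoint_map \<circ> s) ((\<lambda>e. e) \<circ> (midpoint_map \<circ> s))"
      by (simp add: o_def)
    show ?thesis
      by (rule restriction_to_orbit_image_bounds[OF Y Z G_map_pairs_inclusion[OF assms(1) E B p]
            U(1)[OF i] U(2)[OF i] G_map_compose[OF s(1) G_map_midpoint_map] s(2) mid c(1)[OF j] ic[OF j]])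
  qed

  \<comment> \<open>The \<open>m\<close> open sets are made \<open>k\<close>, one for each factor, by repeating the last one.\<close>
  define W where "W = (\<lambda>j. orbit_image ?Y ?\<alpha> (U (min j m)))"
  have "foldr (\<otimes>\<^bsub>singular_cohomology ?Yh\<^esub>) (map (\<lambda>j. cohomology_class ?Yh (c j)) [1..<Suc k]) \<one>\<^bsub>singular_cohomology ?Yh\<^esub>
      = \<zero>\<^bsub>singular_cohomology ?Yh\<^esub>"
  proof (rule cup_product_of_locally_trivial_classes)
    show "topspace ?Yh \<subseteq> (\<Union>j\<in>set [1..<Suc k]. W j)"
    proof
      fix C assume "C \<in> topspace ?Yh"
      then obtain e y where C: "C = orbit_class ?\<Gamma> EG2 \<rho> ?Y ?\<alpha> (e, y)" "e \<in> topspace EG2" "y \<in> topspace ?Y"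
        by (auto simp: homotopy_orbit_space_def topspace_quotient_topology)
      then obtain i where i: "i \<in> {1..m}" "y \<in> U i" using cover by auto
      then have "C \<in> W i"
        using C by (auto simp: W_def orbit_image_def min_def)
      then show "C \<in> (\<Union>j\<in>set [1..<Suc k]. W j)"
        using i(1) m by (intro UN_I[of i]) auto
    qed
    show "openin ?Yh (W j)" if "j \<in> set [1..<Suc k]" for j
      unfolding W_def by (rule openin_orbit_image[OF Y U(1) U(2)]) (use that m in auto)
    show "c j \<in> singular_cocycles ?Yh" if "j \<in> set [1..<Suc k]" for j
      using c(1)[of j] that by auto
    show "cochain_pullback (subtopology ?Yh (W j)) (\<lambda>x. x) (c j) \<in> coboundaries (subtopology ?Yh (W j))"
      if "j \<in> set [1..<Suc k]" for j
      unfolding W_def by (rule res) (use that m in auto)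
  qed
  moreover have "map (\<lambda>j. cohomology_class ?Yh (c j)) [1..<Suc k] = map u [1..<Suc k]"
  proof (rule map_cong[OF refl])
    fix j assume "j \<in> set [1..<Suc k]"
    then have "j \<in> {1..k}" by auto
    then show "cohomology_class ?Yh (c j) = u j" by (rule c(2)[symmetric])
  qed
  ultimately show False
    using assms(7) by (simp only: Let_def borel_cohomology_def)
qed

end
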